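(* Let $N_{rc}$ be the free nilpotent group of rank $r \geq 2$ and class $c \geq 2$. Suppose that $c \geq 4r$ if $r = 2$ or $r = 3$, and that $c \geq 2r$ if $r \geq 4$. Then $N_{rc}$ belongs to the class $R_{\infty}$, i.e. $R(\varphi) = \infty$ for every automorphism $\varphi : N_{rc} \rightarrow N_{rc}$.
   Context: For an automorphism $\varphi$ of a group $G$ (written on the right, $x \mapsto x\varphi$), elements $g, f \in G$ are called $\varphi$-twisted conjugate, written $g \sim_{\varphi} f$, if there exists $x \in G$ with $(x\varphi) g = f x$. This is an equivalence relation; its classes are called Reidemeister classes (or $\varphi$-conjugacy classes), and the Reidemeister number $R(\varphi)$ is the number of these classes, with $R(\varphi) = \infty$ if there are infinitely many. A group $G$ belongs to the class $R_{\infty}$ if $R(\varphi) = \infty$ for every automorphism $\varphi$ of $G$. The free nilpotent group of rank $r$ and class $c$ is $N_{rc} = F_r/\gamma_{c+1}(F_r)$, where $F_r$ is the free group of rank $r$ and $\gamma_1(F_r) = F_r$, $\gamma_{i+1}(F_r) = [\gamma_i(F_r), F_r]$. *)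

theory Defs
  imports "HOL-Algebra.Algebra" "HOL-Library.Extended_Nat"
begin

definition twisted_conj_rel :: "('a, 'b) monoid_scheme \<Rightarrow> ('a \<Rightarrow> 'a) \<Rightarrow> ('a \<times> 'a) set" where
  "twisted_conj_rel G \<phi> =
     {(g, f). g \<in> carrier G \<and> f \<in> carrier G \<and>
        (\<exists>x\<in>carrier G. \<phi> x \<otimes>\<^bsub>G\<^esub> g = f \<otimes>\<^bsub>G\<^esub> x)}"

definition reidemeister_classes :: "('a, 'b) monoid_scheme \<Rightarrow> ('a \<Rightarrow> 'a) \<Rightarrow> 'a set set" where
  "reidemeister_classes G \<phi> = carrier G // twisted_conj_rel G \<phi>"

definition reidemeister_number :: "('a, 'b) monoid_scheme \<Rightarrow> ('a \<Rightarrow> 'a) \<Rightarrow> enat" where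
  "reidemeister_number G \<phi> =
     (if finite (reidemeister_classes G \<phi>) then enat (card (reidemeister_classes G \<phi>)) else \<infinity>)"

definition R_infinity :: "('a, 'b) monoid_scheme \<Rightarrow> bool" where
  "R_infinity G \<longleftrightarrow> group G \<and> (\<forall>\<phi>\<in>iso G G. reidemeister_number G \<phi> = \<infinity>)"

lemma (in group) equiv_twisted_conj_rel:
  assumes "\<phi> \<in> iso G G"
  shows "equiv (carrier G) (twisted_conj_rel G \<phi>)"
proof -
  have hom: "\<phi> \<in> hom G G" using assms by (simp add: iso_def)
  interpret \<phi>: group_hom G G \<phi>
    using hom by unfold_locales
  show ?thesis
  proof (rule equivI)
    show "twisted_conj_rel G \<phi> \<subseteq> carrier G \<times> carrier G"
      by (auto simp: twisted_conj_rel_def)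
    show "refl_on (carrier G) (twisted_conj_rel G \<phi>)"
      by (auto simp: refl_on_def twisted_conj_rel_def intro!: bexI[of _ "\<one>"])
    show "sym (twisted_conj_rel G \<phi>)"
    proof (rule symI)
      fix g f assume "(g, f) \<in> twisted_conj_rel G \<phi>"
      then obtain x where x: "x \<in> carrier G" "g \<in> carrier G" "f \<in> carrier G" "\<phi> x \<otimes> g = f \<otimes> x"
        by (auto simp: twisted_conj_rel_def)
      have "\<phi> (inv x) \<otimes> f = \<phi> (inv x) \<otimes> (f \<otimes> x) \<otimes> inv x"
        using x by (simp add: m_assoc)
      also have "\<dots> = g \<otimes> inv x"
        using x by (simp flip: x(4) m_assoc)
      finally show "(f, g) \<in> twisted_conj_rel G \<phi>"
        using x by (auto simp: twisted_conj_rel_def intro!: bexI[of _ "inv x"])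
    qed
    show "trans (twisted_conj_rel G \<phi>)"
    proof (rule transI)
      fix g f h assume "(g, f) \<in> twisted_conj_rel G \<phi>" "(f, h) \<in> twisted_conj_rel G \<phi>"
      then obtain x y where x: "x \<in> carrier G" "g \<in> carrier G" "f \<in> carrier G" "\<phi> x \<otimes> g = f \<otimes> x"
        and y: "y \<in> carrier G" "h \<in> carrier G" "\<phi> y \<otimes> f = h \<otimes> y"
        by (auto simp: twisted_conj_rel_def)
      have "\<phi> (y \<otimes> x) \<otimes> g = \<phi> y \<otimes> (f \<otimes> x)"
        using x y by (simp add: m_assoc)
      also have "\<dots> = h \<otimes> (y \<otimes> x)"
        using x y by (simp flip: m_assoc)
      finally show "(g, h) \<in> twisted_conj_rel G \<phi>"
        using x y by (auto simp: twisted_conj_rel_def intro!: bexI[of _ "y \<otimes> x"])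
    qed
  qed
qed

text \<open>
  For subgroups \<open>H\<close> and \<open>K\<close>, the other common commutator convention (inverses first) generates the
  same subgroup.
\<close>

definition commutator_subgroup :: "('a, 'b) monoid_scheme \<Rightarrow> 'a set \<Rightarrow> 'a set \<Rightarrow> 'a set" where
  "commutator_subgroup G H K =
     generate G (\<Union>h\<in>H. \<Union>k\<in>K. {h \<otimes>\<^bsub>G\<^esub> k \<otimes>\<^bsub>G\<^esub> inv\<^bsub>G\<^esub> h \<otimes>\<^bsub>G\<^esub> inv\<^bsub>G\<^esub> k})"

text \<open>The series is indexed from 1; the value at 0 is a dummy.\<close>

fun lower_central :: "('a, 'b) monoid_scheme \<Rightarrow> nat \<Rightarrow> 'a set" where
  "lower_central G 0 = carrier G"
| "lower_central G (Suc 0) = carrier G"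
| "lower_central G (Suc (Suc i)) = commutator_subgroup G (lower_central G (Suc i)) (carrier G)"

lemma (in group) commutator_subgroup_normal:
  assumes "H \<lhd> G" "K \<lhd> G"
  shows "commutator_subgroup G H K \<lhd> G"
proof -
  interpret H: normal H G by fact
  interpret K: normal K G by fact
  show ?thesis
    unfolding commutator_subgroup_def
  proof (rule normal_generateI)
    show "(\<Union>h\<in>H. \<Union>k\<in>K. {h \<otimes> k \<otimes> inv h \<otimes> inv k}) \<subseteq> carrier G"
      by auto
    fix x g
    assume "x \<in> (\<Union>h\<in>H. \<Union>k\<in>K. {h \<otimes> k \<otimes> inv h \<otimes> inv k})" and g: "g \<in> carrier G"
    then obtain h k where hk: "h \<in> H" "k \<in> K" and x: "x = h \<otimes> k \<otimes> inv h \<otimes> inv k"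
      by auto
    have c: "h \<in> carrier G" "k \<in> carrier G" using hk by auto
    have conj: "g \<otimes> (a \<otimes> b) \<otimes> inv g = (g \<otimes> a \<otimes> inv g) \<otimes> (g \<otimes> b \<otimes> inv g)"
      if "a \<in> carrier G" "b \<in> carrier G" for a b
      using that g by (simp add: m_assoc inv_solve_left)
    have ci: "g \<otimes> inv a \<otimes> inv g = inv (g \<otimes> a \<otimes> inv g)" if "a \<in> carrier G" for a
      using that g by (simp add: inv_mult_group m_assoc)
    have "g \<otimes> x \<otimes> inv g =
        (g \<otimes> h \<otimes> inv g) \<otimes> (g \<otimes> k \<otimes> inv g) \<otimes> inv (g \<otimes> h \<otimes> inv g) \<otimes> inv (g \<otimes> k \<otimes> inv g)"
      unfolding x using c g by (simp only: conj ci m_closed inv_closed)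
    then show "g \<otimes> x \<otimes> inv g \<in> (\<Union>h\<in>H. \<Union>k\<in>K. {h \<otimes> k \<otimes> inv h \<otimes> inv k})"
      using H.inv_op_closed2[OF g hk(1)] K.inv_op_closed2[OF g hk(2)] by blast
  qed
qed

lemma (in group) lower_central_normal: "lower_central G i \<lhd> G"
proof -
  have "lower_central G (Suc j) \<lhd> G" for j
    by (induction j) (simp_all add: normal_self commutator_subgroup_normal)
  then show ?thesis
    by (cases i) (simp_all add: normal_self)
qed

text \<open>
  A letter \<open>(i, True)\<close> stands for the generator \<open>x\<^sub>i\<close> and \<open>(i, False)\<close> for its inverse.  Elements of
  the free group are the freely reduced words, multiplied by concatenation and free reduction.
\<close>

type_synonym letter = "nat \<times> bool"

definition inv_letter :: "letter \<Rightarrow> letter" where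
  "inv_letter a = (fst a, \<not> snd a)"

definition reduced :: "letter list \<Rightarrow> bool" where
  "reduced = successively (\<lambda>a b. b \<noteq> inv_letter a)"

fun push :: "letter \<Rightarrow> letter list \<Rightarrow> letter list" where
  "push a [] = [a]"
| "push a (b # w) = (if b = inv_letter a then w else a # b # w)"

definition reduce :: "letter list \<Rightarrow> letter list" where
  "reduce w = foldr push w []"

definition free_grp :: "nat \<Rightarrow> letter list monoid" where
  "free_grp r =
     \<lparr>carrier = {w. reduced w \<and> fst ` set w \<subseteq> {..<r}},
      monoid.mult = (\<lambda>v w. reduce (v @ w)),
      monoid.one = []\<rparr>"

definition free_nilpotent_grp :: "nat \<Rightarrow> nat \<Rightarrow> letter list set monoid" where
  "free_nilpotent_grp r c = free_grp r Mod lower_central (free_grp r) (c + 1)"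

lemma inv_letter_inv_letter [simp]: "inv_letter (inv_letter a) = a"
  by (simp add: inv_letter_def)

lemma fst_inv_letter [simp]: "fst (inv_letter a) = fst a"
  by (simp add: inv_letter_def)

lemma reduced_Nil [simp]: "reduced []"
  by (simp add: reduced_def)

lemma reduced_Cons: "reduced (a # w) \<longleftrightarrow> reduced w \<and> (w = [] \<or> hd w \<noteq> inv_letter a)"
  by (cases w) (auto simp: reduced_def)

lemma reduced_push: "reduced w \<Longrightarrow> reduced (push a w)"
  by (cases w) (auto simp: reduced_Cons)

lemma push_inv_letter: "reduced w \<Longrightarrow> push a (push (inv_letter a) w) = w"
proof (cases w)
  case (Cons b v)
  then show "reduced w \<Longrightarrow> ?thesis"
    by (cases v) (auto simp: reduced_Cons)
qed simp

lemma reduced_foldr_push: "reduced w \<Longrightarrow> reduced (foldr push v w)"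
  by (induction v) (auto simp: reduced_push)

lemma reduced_reduce: "reduced (reduce w)"
  by (simp add: reduce_def reduced_foldr_push)

lemma reduce_id: "reduced w \<Longrightarrow> reduce w = w"
proof (induction w)
  case (Cons a w)
  then show ?case by (cases w) (auto simp: reduce_def reduced_Cons)
qed (simp add: reduce_def)

lemma foldr_push_push:
  assumes "reduced w" shows "foldr push (push a v) w = push a (foldr push v w)"
  using push_inv_letter[OF reduced_foldr_push[OF assms]] by (cases v) auto

lemma foldr_push_reduce: "reduced w \<Longrightarrow> foldr push (reduce v) w = foldr push v w"
  by (induction v) (auto simp: reduce_def foldr_push_push)

lemma reduce_append_reduce_left: "reduce (reduce v @ w) = reduce (v @ w)"
  using foldr_push_reduce[OF reduced_reduce[of w], of v] by (simp add: reduce_def)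

lemma reduce_append_reduce_right: "reduce (v @ reduce w) = reduce (v @ w)"
  using reduce_id[OF reduced_reduce[of w]] by (simp add: reduce_def)

lemma set_push: "set (push a w) \<subseteq> insert a (set w)"
  by (cases w) auto

lemma set_reduce: "set (reduce w) \<subseteq> set w"
  using set_push by (induction w) (fastforce simp: reduce_def)+

lemma reduce_inverse: "reduce (map inv_letter (rev w) @ w) = []"
proof (induction w)
  case (Cons a w)
  have "push (inv_letter a) (push a (reduce w)) = reduce w"
    using push_inv_letter[OF reduced_reduce, of "inv_letter a" w] by simp
  then show ?case using Cons by (simp add: reduce_def)
qed (simp add: reduce_def)

lemma group_free_grp: "group (free_grp r)"
proof (rule groupI)
  fix x y z
  assume "x \<in> carrier (free_grp r)" "y \<in> carrier (free_grp r)" "z \<in> carrier (free_grp r)"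
  show "x \<otimes>\<^bsub>free_grp r\<^esub> y \<otimes>\<^bsub>free_grp r\<^esub> z = x \<otimes>\<^bsub>free_grp r\<^esub> (y \<otimes>\<^bsub>free_grp r\<^esub> z)"
    by (simp add: free_grp_def reduce_append_reduce_left reduce_append_reduce_right)
next
  fix x y assume "x \<in> carrier (free_grp r)" "y \<in> carrier (free_grp r)"
  then show "x \<otimes>\<^bsub>free_grp r\<^esub> y \<in> carrier (free_grp r)"
    using set_reduce[of "x @ y"] by (fastforce simp: free_grp_def reduced_reduce)
next
  fix x assume x: "x \<in> carrier (free_grp r)"
  then show "\<one>\<^bsub>free_grp r\<^esub> \<otimes>\<^bsub>free_grp r\<^esub> x = x"
    by (simp add: free_grp_def reduce_id)
  let ?y = "reduce (map inv_letter (rev x))"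
  have "?y \<in> carrier (free_grp r)"
    using x set_reduce[of "map inv_letter (rev x)"] by (fastforce simp: free_grp_def reduced_reduce)
  moreover have "?y \<otimes>\<^bsub>free_grp r\<^esub> x = \<one>\<^bsub>free_grp r\<^esub>"
    by (simp add: free_grp_def reduce_append_reduce_left reduce_inverse)
  ultimately show "\<exists>y\<in>carrier (free_grp r). y \<otimes>\<^bsub>free_grp r\<^esub> x = \<one>\<^bsub>free_grp r\<^esub>"
    by blast
qed (simp add: free_grp_def)

lemma group_free_nilpotent_grp: "group (free_nilpotent_grp r c)"
  unfolding free_nilpotent_grp_def
  by (intro normal.factorgroup_is_group group.lower_central_normal group_free_grp)

lemma (in group) free_grp_universal:
  assumes f: "\<And>i. i < r \<Longrightarrow> f i \<in> carrier G"
  shows "\<exists>h\<in>hom (free_grp r) G. \<forall>i<r. h [(i, True)] = f i"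
proof -
  define l where "l = (\<lambda>a :: letter. if snd a then f (fst a) else inv (f (fst a)))"
  define h where "h = (\<lambda>w. foldr (\<lambda>a x. l a \<otimes> x) w \<one>)"
  have l: "l a \<in> carrier G" if "fst a < r" for a
    using that f by (auto simp: l_def)
  have l_inv: "l a \<otimes> l (inv_letter a) = \<one>" if "fst a < r" for a
    using that f by (auto simp: l_def inv_letter_def)
  have h: "h w \<in> carrier G" if "fst ` set w \<subseteq> {..<r}" for w
    using that by (induction w) (auto simp: h_def l)
  have h_push: "h (push a w) = l a \<otimes> h w" if "fst a < r" "fst ` set w \<subseteq> {..<r}" for a w
  proof (cases w)
    case (Cons b v)
    have "l a \<otimes> (l (inv_letter a) \<otimes> h v) = h v"
      using that Cons h[of v] l l_inv[of a] by (simp flip: m_assoc)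
    then show ?thesis using Cons by (auto simp: h_def)
  qed (simp add: h_def)
  have h_reduce: "h (reduce w) = h w" if "fst ` set w \<subseteq> {..<r}" for w
    using that
  proof (induction w)
    case (Cons a w)
    have "fst ` set (reduce w) \<subseteq> {..<r}"
      using Cons.prems set_reduce[of w] by auto
    then show ?case
      using Cons h_push[of a "reduce w"] by (simp add: reduce_def h_def)
  qed (simp add: reduce_def)
  have h_append: "h (v @ w) = h v \<otimes> h w"
    if "fst ` set v \<subseteq> {..<r}" "fst ` set w \<subseteq> {..<r}" for v w
    using that(1)
  proof (induction v)
    case Nil
    then show ?case using h[OF that(2)] by (simp add: h_def)
  next
    case (Cons a v)
    then have "l a \<otimes> h (v @ w) = l a \<otimes> h v \<otimes> h w"
      using h[of v] h[OF that(2)] l[of a] by (simp add: m_assoc)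
    then show ?case by (simp add: h_def)
  qed
  have "h \<in> hom (free_grp r) G"
  proof (rule homI)
    fix v w assume "v \<in> carrier (free_grp r)" "w \<in> carrier (free_grp r)"
    then have "fst ` set v \<subseteq> {..<r}" "fst ` set w \<subseteq> {..<r}"
      by (simp_all add: free_grp_def)
    then show "h (v \<otimes>\<^bsub>free_grp r\<^esub> w) = h v \<otimes> h w"
      using h_reduce[of "v @ w"] h_append[of v w] by (simp add: free_grp_def image_Un)
  qed (simp add: free_grp_def h)
  moreover have "h [(i, True)] = f i" if "i < r" for i
    using f[OF that] by (simp add: h_def l_def)
  ultimately show ?thesis by blast
qed

end

theory Submission
  imports Defs "HOL-Library.Multiset" "Jordan_Normal_Form.Schur_Decomposition"
begin

text \<open>
  Let \<open>\<phi>\<close> be an automorphism of \<open>N = F/\<gamma>\<^bsub>c+1\<^esub>(F)\<close>, where \<open>F\<close> is free on \<open>x\<^sub>0, \<dots>, x\<^bsub>r-1\<^esub>\<close>.  A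
  filtration of \<open>F\<close> is used on whose graded pieces \<open>\<phi>\<close> acts linearly; a nonzero vector fixed by
  one of these linear maps makes the Reidemeister number infinite, and such a vector exists in
  degree \<open>2r\<close>, which is at most \<open>c\<close>.

  The filtration comes from the Magnus homomorphism \<open>x\<^sub>i \<mapsto> 1 + x\<^sub>i\<close> into power series in
  noncommuting variables.  Let \<open>D\<^sub>n\<close> consist of the elements of \<open>F\<close> whose image is \<open>1\<close> plus terms of
  degree at least \<open>n\<close>; the degree \<open>n\<close> part is then the leading term.  Leading terms in degree \<open>n\<close>
  add up under multiplication, \<open>\<gamma>\<^sub>n(F) \<subseteq> D\<^sub>n\<close>, and the leading term of a commutator is the Lie
  bracket of the leading terms, so iterated brackets of the variables occur as leading terms.
  Since \<open>F\<close> is free, \<open>\<phi>\<close> lifts to an endomorphism \<open>\<theta>\<close> of \<open>F\<close>.  On power series \<open>\<theta>\<close> acts by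
  substituting a series without constant term for each variable, hence on leading terms by the
  linear substitution \<open>T\<close> given by the matrix \<open>A\<close> of \<open>\<theta>\<close> on the abelianization.

  Fixed vectors give infinitely many classes (\<open>infinitely_many_twisted_classes\<close>): take the least
  \<open>n\<close> such that \<open>T\<close> has a nonzero fixed vector in the complex span \<open>K\<^sub>n\<close> of the leading terms of
  degree \<open>n\<close>.  Then \<open>T - 1\<close> is not injective on \<open>K\<^sub>n\<close>, hence not surjective, because \<open>K\<^sub>n\<close> has finite
  dimension, and some \<open>x \<in> D\<^sub>n\<close> has its leading term \<open>v\<close> outside \<open>(T - 1)K\<^sub>n\<close>.  The powers of \<open>x\<close>
  are pairwise not twisted conjugate.  Indeed, let \<open>\<theta>(y) x\<^sup>k = x\<^sup>l y\<close> up to terms of degree above \<open>c\<close>.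
  In degrees \<open>j < n\<close> this says that the leading term of \<open>y\<close> is fixed by \<open>T\<close>, so it vanishes by the
  choice of \<open>n\<close>; therefore \<open>y \<in> D\<^sub>n\<close>.  In degree \<open>n\<close> it says \<open>(l - k) v = (T - 1) m\<close> for the leading
  term \<open>m\<close> of \<open>y\<close>, so \<open>k = l\<close>.

  A fixed vector in degree \<open>2r\<close> (\<open>fixed_lie_element\<close>): \<open>det A = \<plusminus>1\<close>, because \<open>A\<close> and the matrix
  belonging to \<open>\<phi>\<^sup>-\<^sup>1\<close> are inverse integral matrices.  Over the complex numbers \<open>A\<close> is similar to an
  upper triangular matrix \<open>B\<close>.  The left-normed bracket
  \<open>u = [x\<^sub>0, x\<^sub>1, x\<^sub>1, x\<^sub>2, x\<^sub>2, \<dots>, x\<^bsub>r-1\<^esub>, x\<^bsub>r-1\<^esub>, x\<^sub>0]\<close> is not zero and contains each variable exactly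
  twice, so \<open>B\<close> multiplies it by \<open>(det B)\<^sup>2 = 1\<close>, up to words with a smaller sum of indices.  If
  \<open>B - 1\<close> were injective on the Lie elements of degree \<open>2r\<close>, it would be bijective on the subspace
  of those that involve only words with a smaller index sum than \<open>u\<close>; this subspace contains
  \<open>(B - 1)u\<close>, so it would contain \<open>u\<close>, which is absurd.  Squaring the determinant deals with both
  signs at once.
\<close>

section \<open>Endomorphisms of finite-dimensional subspaces\<close>

text \<open>
  The space of all power series is infinite-dimensional, so dimensions are counted inside \<open>K\<close>.  A basis of
  \<open>K\<close> is mapped to an independent set of the same size if \<open>f\<close> is injective, and to a spanning set if
  \<open>f\<close> is surjective, and either property of the image forces the other by counting.
\<close>
lemma (in vector_space) finite_dim_inj_on_iff_surj_on:
  assumes lin: "Vector_Spaces.linear scale scale f"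
    and sub: "subspace K" and K: "K \<subseteq> span B" "finite B" and fK: "f ` K \<subseteq> K"
  shows "inj_on f K \<longleftrightarrow> K \<subseteq> f ` K"
proof -
  interpret lin: Vector_Spaces.linear scale scale f by fact
  obtain C where C: "C \<subseteq> K" "independent C" "K \<subseteq> span C"
    using maximal_independent_subset by blast
  have KC: "K = span C" using C(3) span_minimal[OF C(1) sub] by blast
  have fin: "finite C" using independent_span_bound[OF K(2) C(2)] C(1) K(1) by blast
  have img: "f ` K = span (f ` C)" by (simp add: KC lin.span_image)
  show ?thesis
  proof
    assume inj: "inj_on f K"
    then have ind: "independent (f ` C)"
      using lin.independent_inj_on_image[OF C(2)] KC by simp
    have card: "card (f ` C) = card C"
      using inj C(1) by (meson card_image inj_on_subset)
    show "K \<subseteq> f ` K"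
    proof
      fix v assume v: "v \<in> K"
      show "v \<in> f ` K"
      proof (rule ccontr)
        assume "v \<notin> f ` K"
        then have v': "v \<notin> span (f ` C)" using img by simp
        then have "independent (insert v (f ` C))" using ind independent_insert by auto
        moreover have "insert v (f ` C) \<subseteq> span C" using v fK C(1) KC by blast
        ultimately have "card (insert v (f ` C)) \<le> card C"
          using independent_span_bound[OF fin] by blast
        moreover have "v \<notin> f ` C" using v' span_base by blast
        ultimately show False using fin card by simp
      qed
    qed
  next
    assume surj: "K \<subseteq> f ` K"
    obtain D where D: "D \<subseteq> f ` C" "independent D" "f ` C \<subseteq> span D"
      using maximal_independent_subset by blast
    have finD: "finite D" using D(1) fin finite_subset by blast
    have "C \<subseteq> span D"
      using C(1) surj img span_minimal[OF D(3) subspace_span] by blast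
    then have le: "card C \<le> card D" using independent_span_bound[OF finD C(2)] by blast
    have "card D \<le> card (f ` C)" using D(1) fin by (simp add: card_mono)
    moreover have "card (f ` C) \<le> card C" using fin by (rule card_image_le)
    ultimately have eq: "card (f ` C) = card C" "card D = card (f ` C)" using le by auto
    then have "D = f ` C" using D(1) fin by (simp add: card_subset_eq)
    then have "independent (f ` C)" using D(2) by simp
    moreover have "inj_on f C" using eq(1) fin by (simp add: eq_card_imp_inj_on)
    ultimately show "inj_on f K" using lin.inj_on_span_iff_independent_image KC by blast
  qed
qed

section \<open>Power series in noncommuting variables\<close>

datatype ncseries = Series (wcoeff: "nat list \<Rightarrow> complex")

lemma ncseries_eqI: "(\<And>w. wcoeff f w = wcoeff g w) \<Longrightarrow> f = g"
  by (cases f, cases g) auto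

text \<open>
  The convolution \<open>conv f g w = (\<Sum>(u, v) | u @ v = w. f u * g v)\<close>, organized by the first letter of the word:
  either the first factor contributes the empty word, or it takes the first letter.  In this form
  the ring laws follow by induction on the word, without reindexing sums over splittings.
\<close>
fun conv :: "(nat list \<Rightarrow> complex) \<Rightarrow> (nat list \<Rightarrow> complex) \<Rightarrow> nat list \<Rightarrow> complex" where
  "conv f g [] = f [] * g []"
| "conv f g (a # w) = f [] * g (a # w) + conv (\<lambda>v. f (a # v)) g w"

lemma conv_add_left: "conv (\<lambda>v. f v + g v) h w = conv f h w + conv g h w"
  by (induction w arbitrary: f g) (simp_all add: algebra_simps)

lemma conv_add_right: "conv f (\<lambda>v. g v + h v) w = conv f g w + conv f h w"
  by (induction w arbitrary: f) (simp_all add: algebra_simps)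

lemma conv_scale_left: "conv (\<lambda>v. c * f v) h w = c * conv f h w"
  by (induction w arbitrary: f) (simp_all add: algebra_simps)

lemma conv_zero_left: "conv (\<lambda>v. 0) h w = 0"
  by (induction w) simp_all

lemma conv_assoc: "conv (conv f g) h w = conv f (conv g h) w"
proof (induction w arbitrary: f g)
  case (Cons a w)
  have "conv (\<lambda>v. conv f g (a # v)) h w
      = f [] * conv (\<lambda>v. g (a # v)) h w + conv (\<lambda>v. f (a # v)) (conv g h) w"
    by (simp add: conv_add_left conv_scale_left Cons.IH)
  then show ?case by (simp add: algebra_simps)
qed (simp add: algebra_simps)

lemma conv_one_left: "conv (\<lambda>v. if v = [] then 1 else 0) g w = g w"
  by (cases w) (simp_all add: conv_zero_left)

lemma conv_one_right: "conv f (\<lambda>v. if v = [] then 1 else 0) w = f w"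
  by (induction w arbitrary: f) simp_all

instantiation ncseries :: ring_1
begin

definition "0 = Series (\<lambda>w. 0)"
definition "1 = Series (\<lambda>w. if w = [] then 1 else 0)"
definition "f + g = Series (\<lambda>w. wcoeff f w + wcoeff g w)"
definition "f - g = Series (\<lambda>w. wcoeff f w - wcoeff g w)"
definition "- f = Series (\<lambda>w. - wcoeff f w)"
definition "f * g = Series (conv (wcoeff f) (wcoeff g))"

instance
  by standard
    (auto simp: zero_ncseries_def one_ncseries_def plus_ncseries_def minus_ncseries_def
      uminus_ncseries_def times_ncseries_def conv_add_left conv_add_right conv_assoc
      conv_one_left conv_one_right fun_eq_iff
      intro!: ncseries_eqI)

end

lemma wcoeff_zero [simp]: "wcoeff 0 w = 0"
  and wcoeff_one: "wcoeff 1 w = (if w = [] then 1 else 0)"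
  and wcoeff_add [simp]: "wcoeff (f + g) w = wcoeff f w + wcoeff g w"
  and wcoeff_diff [simp]: "wcoeff (f - g) w = wcoeff f w - wcoeff g w"
  and wcoeff_uminus [simp]: "wcoeff (- f) w = - wcoeff f w"
  by (simp_all add: zero_ncseries_def one_ncseries_def plus_ncseries_def minus_ncseries_def
      uminus_ncseries_def)

lemma wcoeff_sum [simp]: "wcoeff (\<Sum>i\<in>I. f i) w = (\<Sum>i\<in>I. wcoeff (f i) w)"
  by (induction I rule: infinite_finite_induct) simp_all

definition scale :: "complex \<Rightarrow> ncseries \<Rightarrow> ncseries" where
  "scale c f = Series (\<lambda>w. c * wcoeff f w)"

lemma wcoeff_scale [simp]: "wcoeff (scale c f) w = c * wcoeff f w"
  by (simp add: scale_def)

interpretation series: vector_space scale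
  by standard (auto intro!: ncseries_eqI simp: algebra_simps)

text \<open>
  Every series is its constant term plus the sum of \<open>letter a * tail a f\<close> over all letters \<open>a\<close>.
\<close>
definition tail :: "nat \<Rightarrow> ncseries \<Rightarrow> ncseries" where
  "tail a f = Series (\<lambda>w. wcoeff f (a # w))"

lemma wcoeff_tail [simp]: "wcoeff (tail a f) w = wcoeff f (a # w)"
  by (simp add: tail_def)

lemma tail_add [simp]: "tail a (f + g) = tail a f + tail a g"
  and tail_scale [simp]: "tail a (scale c f) = scale c (tail a f)"
  and tail_one [simp]: "tail a 1 = 0"
  and tail_zero [simp]: "tail a 0 = 0"
  by (auto intro!: ncseries_eqI simp: wcoeff_one)

lemma wcoeff_mult_Nil [simp]: "wcoeff (f * g) [] = wcoeff f [] * wcoeff g []"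
  by (simp add: times_ncseries_def)

lemma wcoeff_mult_Cons:
  "wcoeff (f * g) (a # w) = wcoeff f [] * wcoeff g (a # w) + wcoeff (tail a f * g) w"
  by (simp add: times_ncseries_def tail_def)

lemma tail_mult: "tail a (f * g) = scale (wcoeff f []) (tail a g) + tail a f * g"
  by (auto intro!: ncseries_eqI simp: wcoeff_mult_Cons)

lemma scale_mult_left: "scale c f * g = scale c (f * g)"
  by (auto intro!: ncseries_eqI simp: times_ncseries_def scale_def conv_scale_left)

lemma scale_mult_right: "f * scale c g = scale c (f * g)"
proof -
  have "wcoeff (f * scale c g) w = c * wcoeff (f * g) w" for w
    by (induction w arbitrary: f) (simp_all add: wcoeff_mult_Cons algebra_simps)
  then show ?thesis by (auto intro!: ncseries_eqI)
qed

definition letter :: "nat \<Rightarrow> ncseries" where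
  "letter i = Series (\<lambda>w. if w = [i] then 1 else 0)"

lemma wcoeff_letter: "wcoeff (letter i) w = (if w = [i] then 1 else 0)"
  by (simp add: letter_def)

lemma tail_letter: "tail a (letter i) = (if a = i then 1 else 0)"
  by (auto intro!: ncseries_eqI simp: wcoeff_letter wcoeff_one)

lemma wcoeff_letter_mult_Cons: "wcoeff (letter i * f) (a # w) = (if a = i then wcoeff f w else 0)"
  by (simp add: wcoeff_mult_Cons wcoeff_letter tail_letter)

lemma wcoeff_mult_letter_snoc:
  "wcoeff (f * letter i) (w @ [a]) = (if a = i then wcoeff f w else 0)"
  by (induction w arbitrary: f) (simp_all add: wcoeff_mult_Cons wcoeff_letter)

section \<open>The degree filtration\<close>

definition ord_ge :: "nat \<Rightarrow> ncseries \<Rightarrow> bool" where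
  "ord_ge n f \<longleftrightarrow> (\<forall>w. length w < n \<longrightarrow> wcoeff f w = 0)"

lemma ord_ge_0 [simp]: "ord_ge 0 f" by (simp add: ord_ge_def)

text \<open>
  This reduction of the order of \<open>f\<close> to the orders of its tails drives all inductions on the degree.
\<close>
lemma ord_ge_Suc_iff: "ord_ge (Suc n) f \<longleftrightarrow> wcoeff f [] = 0 \<and> (\<forall>a. ord_ge n (tail a f))"
  unfolding ord_ge_def
  by (auto simp: all_conj_distrib)
    (metis (no_types) length_0_conv length_Suc_conv less_Suc_eq_0_disj list.exhaust length_Cons Suc_less_eq)

lemma ord_ge_mono: "ord_ge n f \<Longrightarrow> m \<le> n \<Longrightarrow> ord_ge m f"
  by (auto simp: ord_ge_def)

lemma ord_ge_zero [simp]: "ord_ge n 0" by (simp add: ord_ge_def)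

lemma ord_ge_add: "ord_ge n f \<Longrightarrow> ord_ge n g \<Longrightarrow> ord_ge n (f + g)"
  and ord_ge_diff: "ord_ge n f \<Longrightarrow> ord_ge n g \<Longrightarrow> ord_ge n (f - g)"
  and ord_ge_uminus: "ord_ge n f \<Longrightarrow> ord_ge n (- f)"
  by (auto simp: ord_ge_def)

lemma ord_ge_sum: "(\<And>i. i \<in> I \<Longrightarrow> ord_ge n (f i)) \<Longrightarrow> ord_ge n (\<Sum>i\<in>I. f i)"
  by (induction I rule: infinite_finite_induct) (auto intro: ord_ge_add)

lemma ord_ge_mult:
  assumes "ord_ge m f" "ord_ge n g" shows "ord_ge (m + n) (f * g)"
  using assms(1)
proof (induction m arbitrary: f)
  case 0
  have "wcoeff (f * g) w = 0" if "length w < n" for w f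
    using that assms(2)
    by (induction w arbitrary: f) (auto simp: wcoeff_mult_Cons ord_ge_def)
  then show ?case by (simp add: ord_ge_def)
next
  case (Suc m)
  then show ?case by (simp add: ord_ge_Suc_iff tail_mult)
qed

text \<open>
  Identities between series are proved modulo terms of degree at least \<open>n\<close>, for every \<open>n\<close>.
\<close>
lemma ord_ge_all_eq: "(\<And>n. ord_ge n (f - g)) \<Longrightarrow> f = g"
  by (rule ncseries_eqI) (metis lessI ord_ge_def right_minus_eq wcoeff_diff)

definition hom_part :: "nat \<Rightarrow> ncseries \<Rightarrow> ncseries" where
  "hom_part n f = Series (\<lambda>w. if length w = n then wcoeff f w else 0)"

lemma wcoeff_hom_part: "wcoeff (hom_part n f) w = (if length w = n then wcoeff f w else 0)"
  by (simp add: hom_part_def)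

lemma hom_part_add: "hom_part n (f + g) = hom_part n f + hom_part n g"
  and hom_part_diff: "hom_part n (f - g) = hom_part n f - hom_part n g"
  and hom_part_zero [simp]: "hom_part n 0 = 0"
  by (auto intro!: ncseries_eqI simp: wcoeff_hom_part)

lemma hom_part_eq_0_iff: "ord_ge n f \<Longrightarrow> hom_part n f = 0 \<longleftrightarrow> ord_ge (Suc n) f"
  by (auto simp: ord_ge_def less_Suc_eq  intro!: ncseries_eqI simp: wcoeff_hom_part)
    (metis wcoeff_hom_part wcoeff_zero)

lemma hom_part_eq: "ord_ge (Suc n) (f - g) \<Longrightarrow> hom_part n f = hom_part n g"
  by (auto simp: ord_ge_def intro!: ncseries_eqI simp: wcoeff_hom_part)

lemma ord_ge_hom_part: "ord_ge n (hom_part n f)"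
  by (auto simp: ord_ge_def wcoeff_hom_part)

lemma ord_ge_diff_hom_part: "ord_ge n f \<Longrightarrow> ord_ge (Suc n) (f - hom_part n f)"
  by (auto simp: ord_ge_def wcoeff_hom_part less_Suc_eq)

section \<open>Support and integrality\<close>

definition supported :: "nat \<Rightarrow> ncseries \<Rightarrow> bool" where
  "supported r f \<longleftrightarrow> (\<forall>w. \<not> set w \<subseteq> {..<r} \<longrightarrow> wcoeff f w = 0)"

definition integral_series :: "ncseries \<Rightarrow> bool" where
  "integral_series f \<longleftrightarrow> (\<forall>w. wcoeff f w \<in> \<int>)"

lemma supported_zero [simp]: "supported r 0"
  and supported_one [simp]: "supported r 1"
  and supported_letter: "i < r \<Longrightarrow> supported r (letter i)"
  and supported_add: "supported r f \<Longrightarrow> supported r g \<Longrightarrow> supported r (f + g)"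
  and supported_diff: "supported r f \<Longrightarrow> supported r g \<Longrightarrow> supported r (f - g)"
  and supported_scale: "supported r f \<Longrightarrow> supported r (scale c f)"
  and supported_tail: "supported r f \<Longrightarrow> supported r (tail a f)"
  by (auto simp: supported_def wcoeff_one wcoeff_letter wcoeff_hom_part)

lemma supported_sum: "(\<And>i. i \<in> I \<Longrightarrow> supported r (f i)) \<Longrightarrow> supported r (\<Sum>i\<in>I. f i)"
  by (induction I rule: infinite_finite_induct) (auto intro: supported_add)

lemma supported_mult:
  assumes "supported r f" "supported r g" shows "supported r (f * g)"
proof -
  have "wcoeff (f * g) w = 0" if "\<not> set w \<subseteq> {..<r}" for w
    using that assms(1)
  proof (induction w arbitrary: f)
    case (Cons a w)
    have "wcoeff (tail a f * g) w = 0"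
    proof (cases "a < r")
      case True
      then show ?thesis using Cons by (auto simp: supported_tail)
    next
      case False
      then have "tail a f = 0" using Cons.prems(2)
        by (auto intro!: ncseries_eqI simp: supported_def)
      then show ?thesis by simp
    qed
    moreover have "wcoeff g (a # w) = 0" using assms(2) Cons.prems(1) by (simp add: supported_def)
    ultimately show ?case by (simp add: wcoeff_mult_Cons)
  qed simp
  then show ?thesis by (simp add: supported_def)
qed

lemma integral_zero [simp]: "integral_series 0"
  and integral_one [simp]: "integral_series 1"
  and integral_letter [simp]: "integral_series (letter i)"
  and integral_add: "integral_series f \<Longrightarrow> integral_series g \<Longrightarrow> integral_series (f + g)"
  and integral_diff: "integral_series f \<Longrightarrow> integral_series g \<Longrightarrow> integral_series (f - g)"
  and integral_scale: "c \<in> \<int> \<Longrightarrow> integral_series f \<Longrightarrow> integral_series (scale c f)"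
  and integral_tail: "integral_series f \<Longrightarrow> integral_series (tail a f)"
  by (auto simp: integral_series_def wcoeff_one wcoeff_letter)

lemma integral_sum:
  "(\<And>i. i \<in> I \<Longrightarrow> integral_series (f i)) \<Longrightarrow> integral_series (\<Sum>i\<in>I. f i)"
  by (induction I rule: infinite_finite_induct) (auto intro: integral_add)

lemma integral_mult:
  assumes "integral_series f" "integral_series g" shows "integral_series (f * g)"
proof -
  have "wcoeff (f * g) w \<in> \<int>" for w
    using assms
  proof (induction w arbitrary: f)
    case (Cons a w)
    have "wcoeff (tail a f * g) w \<in> \<int>" using Cons by (simp add: integral_tail)
    then show ?case using Cons.prems by (simp add: wcoeff_mult_Cons integral_series_def)
  qed (simp add: integral_series_def)
  then show ?thesis by (simp add: integral_series_def)
qed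

section \<open>Substitution endomorphisms\<close>

text \<open>
  The substitution \<open>x\<^sub>i \<mapsto> p i\<close> is the solution of the recursion \<open>subst_rec\<close> below, which removes the
  first letter of every word.  The iterates \<open>subst_approx\<close> start from \<open>0\<close>; if no \<open>p i\<close> has a constant
  term, then each of them is correct in one degree more than its predecessor, so the coefficient at a
  word \<open>w\<close> is stable from step \<open>length w + 1\<close> on.  Letters outside \<open>{..<r}\<close> are sent to \<open>0\<close>.
\<close>
primrec subst_approx :: "nat \<Rightarrow> (nat \<Rightarrow> ncseries) \<Rightarrow> nat \<Rightarrow> ncseries \<Rightarrow> ncseries" where
  "subst_approx r p 0 f = 0"
| "subst_approx r p (Suc n) f =
     scale (wcoeff f []) 1 + (\<Sum>i<r. p i * subst_approx r p n (tail i f))"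

definition subst :: "nat \<Rightarrow> (nat \<Rightarrow> ncseries) \<Rightarrow> ncseries \<Rightarrow> ncseries" where
  "subst r p f = Series (\<lambda>w. wcoeff (subst_approx r p (Suc (length w)) f) w)"

lemma subst_approx_add:
  "subst_approx r p n (f + g) = subst_approx r p n f + subst_approx r p n g"
  by (induction n arbitrary: f g)
    (simp_all add: series.scale_left_distrib distrib_left sum.distrib)

lemma subst_approx_scale: "subst_approx r p n (scale c f) = scale c (subst_approx r p n f)"
  by (induction n arbitrary: f)
    (simp_all add: series.scale_right_distrib series.scale_sum_right scale_mult_right)

lemma subst_add: "subst r p (f + g) = subst r p f + subst r p g"
  by (rule ncseries_eqI) (simp add: subst_def subst_approx_add del: subst_approx.simps)

lemma subst_scale: "subst r p (scale c f) = scale c (subst r p f)"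
  by (rule ncseries_eqI) (simp add: subst_def subst_approx_scale del: subst_approx.simps)

lemma linear_subst: "Vector_Spaces.linear scale scale (subst r p)"
  by unfold_locales (simp_all add: subst_add subst_scale)

interpretation subst: Vector_Spaces.linear scale scale "subst r p" for r p
  by (rule linear_subst)

lemma subst_approx_coherent:
  assumes "\<And>i. i < r \<Longrightarrow> ord_ge 1 (p i)"
  shows "ord_ge n (subst_approx r p (n + k) f - subst_approx r p n f)"
proof (induction n arbitrary: f)
  case (Suc n)
  have "ord_ge (1 + n) (\<Sum>i<r. p i * (subst_approx r p (n + k) (tail i f) - subst_approx r p n (tail i f)))"
    by (intro ord_ge_sum ord_ge_mult assms Suc) simp
  then show ?case by (simp add: algebra_simps sum_subtractf)
qed simp

lemma ord_ge_subst_approx: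
  assumes "\<And>i. i < r \<Longrightarrow> ord_ge 1 (p i)"
  shows "ord_ge n (subst r p f - subst_approx r p n f)"
proof -
  have "wcoeff (subst_approx r p n f) w = wcoeff (subst_approx r p (Suc (length w)) f) w"
    if "length w < n" for w
  proof -
    obtain k where "n = Suc (length w) + k" using \<open>length w < n\<close> less_iff_Suc_add by auto
    then show ?thesis
      using subst_approx_coherent[of r p "Suc (length w)" k f, OF assms]
      by (simp add: ord_ge_def del: subst_approx.simps)
  qed
  then show ?thesis by (simp add: ord_ge_def subst_def del: subst_approx.simps)
qed

lemma subst_rec:
  assumes "\<And>i. i < r \<Longrightarrow> ord_ge 1 (p i)"
  shows "subst r p f = scale (wcoeff f []) 1 + (\<Sum>i<r. p i * subst r p (tail i f))"
proof (rule ord_ge_all_eq)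
  fix n
  have 1: "ord_ge (1 + n) (\<Sum>i<r. p i * (subst r p (tail i f) - subst_approx r p n (tail i f)))"
    by (intro ord_ge_sum ord_ge_mult assms ord_ge_subst_approx) simp_all
  have 2: "ord_ge (1 + n) (subst r p f - subst_approx r p (Suc n) f)"
    using ord_ge_subst_approx[of r p "Suc n" f, OF assms] by simp
  have "ord_ge (1 + n) (subst r p f - (scale (wcoeff f []) 1 + (\<Sum>i<r. p i * subst r p (tail i f))))"
    using ord_ge_diff[OF 2 1] by (simp add: algebra_simps sum_subtractf)
  then show "ord_ge n (subst r p f - (scale (wcoeff f []) 1 + (\<Sum>i<r. p i * subst r p (tail i f))))"
    by (rule ord_ge_mono) simp
qed

text \<open>
  The recursion has only one solution, since the difference of two solutions gains one degree in
  each unfolding.  The predicate \<open>Q\<close> admits candidates \<open>H\<close> that satisfy it only on a class of series closed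
  under \<open>tail\<close>.
\<close>
lemma subst_unique:
  assumes p: "\<And>i. i < r \<Longrightarrow> ord_ge 1 (p i)"
    and H: "\<And>f. Q f \<Longrightarrow> H f = scale (wcoeff f []) 1 + (\<Sum>i<r. p i * H (tail i f))"
    and Q: "\<And>f i. Q f \<Longrightarrow> i < r \<Longrightarrow> Q (tail i f)" and "Q f"
  shows "subst r p f = H f"
proof (rule ord_ge_all_eq)
  show "ord_ge n (subst r p f - H f)" for n
    using \<open>Q f\<close>
  proof (induction n arbitrary: f)
    case (Suc n)
    have "subst r p f - H f = (\<Sum>i<r. p i * (subst r p (tail i f) - H (tail i f)))"
      by (subst subst_rec[OF p], simp, subst H[OF Suc.prems])
        (simp add: algebra_simps sum_subtractf)
    moreover have "ord_ge (1 + n) \<dots>"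
      by (intro ord_ge_sum ord_ge_mult p Suc Q) simp_all
    ultimately show ?case by simp
  qed simp
qed

lemma subst_one: 
  assumes "\<And>i. i < r \<Longrightarrow> ord_ge 1 (p i)" shows "subst r p 1 = 1"
  by (subst subst_rec[OF assms]) (simp_all add: wcoeff_one)

lemma subst_letter:
  assumes "\<And>i. i < r \<Longrightarrow> ord_ge 1 (p i)" "j < r" shows "subst r p (letter j) = p j"
proof -
  have "(\<Sum>i<r. p i * subst r p (tail i (letter j))) = (\<Sum>i<r. if i = j then p i else 0)"
    by (rule sum.cong) (auto simp: tail_letter subst_one[OF assms(1)])
  then show ?thesis
    using assms(2) by (subst subst_rec[OF assms(1)]) (simp_all add: wcoeff_letter)
qed

text \<open>
  By \<open>tail i (f * g) = f\<^sub>0 tail i g + tail i f * g\<close>, with \<open>f\<^sub>0\<close> the constant term of \<open>f\<close>, the defect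
  \<open>subst (f * g) - subst f * subst g\<close> is \<open>\<Sum>i. p i * defect (tail i f) g\<close>, and the factors \<open>p i\<close> raise
  its order at every unfolding.
\<close>
lemma subst_mult:
  assumes p: "\<And>i. i < r \<Longrightarrow> ord_ge 1 (p i)"
  shows "subst r p (f * g) = subst r p f * subst r p g"
proof (rule ord_ge_all_eq)
  show "ord_ge n (subst r p (f * g) - subst r p f * subst r p g)" for n
  proof (induction n arbitrary: f)
    case (Suc n)
    let ?S = "subst r p"
    have "?S (f * g) = scale (wcoeff f []) (scale (wcoeff g []) 1 + (\<Sum>i<r. p i * ?S (tail i g)))
        + (\<Sum>i<r. p i * ?S (tail i f * g))"
      by (subst subst_rec[OF p], simp)
        (simp add: tail_mult subst_add subst_scale distrib_left sum.distrib scale_mult_right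
          series.scale_right_distrib series.scale_sum_right)
    also have "\<dots> = scale (wcoeff f []) (?S g) + (\<Sum>i<r. p i * ?S (tail i f * g))"
      using subst_rec[of r p g, OF p] by simp
    also have "\<dots> - ?S f * ?S g = (\<Sum>i<r. p i * (?S (tail i f * g) - ?S (tail i f) * ?S g))"
    proof -
      have "?S f * ?S g = scale (wcoeff f []) (?S g) + (\<Sum>i<r. p i * ?S (tail i f) * ?S g)"
        by (subst subst_rec[of r p f, OF p], simp)
         (simp add: distrib_right scale_mult_left sum_distrib_right)
      then show ?thesis by (simp add: right_diff_distrib sum_subtractf mult.assoc)
    qed
    finally have eq: "?S (f * g) - ?S f * ?S g
      = (\<Sum>i<r. p i * (?S (tail i f * g) - ?S (tail i f) * ?S g))" .
    have "ord_ge (1 + n) (\<Sum>i<r. p i * (?S (tail i f * g) - ?S (tail i f) * ?S g))"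
      by (intro ord_ge_sum ord_ge_mult p Suc) simp_all
    then show ?case using eq by simp
  qed simp
qed

lemma subst_subst:
  assumes p: "\<And>i. i < r \<Longrightarrow> ord_ge 1 (p i)" and q: "\<And>i. i < s \<Longrightarrow> ord_ge 1 (q i)"
    and pq: "\<And>i. i < r \<Longrightarrow> ord_ge 1 (subst s q (p i))"
  shows "subst r (\<lambda>i. subst s q (p i)) f = subst s q (subst r p f)"
proof (rule subst_unique[where Q = "\<lambda>_. True"])
  show "subst s q (subst r p f) =
         scale (wcoeff f []) 1 + (\<Sum>i<r. subst s q (p i) * subst s q (subst r p (tail i f)))" for f
    by (subst subst_rec[OF p], simp)
      (simp add: subst_add subst_scale subst_one[OF q] subst.sum subst_mult[OF q])
qed (use pq in auto)

lemma letter_expansion: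
  assumes "supported r f"
  shows "f = scale (wcoeff f []) 1 + (\<Sum>i<r. letter i * tail i f)"
proof (rule ncseries_eqI)
  fix w
  show "wcoeff f w = wcoeff (scale (wcoeff f []) 1 + (\<Sum>i<r. letter i * tail i f)) w"
    using assms by (cases w) (auto simp: wcoeff_one wcoeff_letter wcoeff_letter_mult_Cons supported_def)
qed

lemma ord_ge_letter: "ord_ge 1 (letter i)"
  by (simp add: ord_ge_def wcoeff_letter)

lemma subst_letters: 
  assumes "supported r f" shows "subst r letter f = f"
  by (rule subst_unique[where Q = "supported r" and H = "\<lambda>f. f"])
    (use assms in \<open>auto simp: letter_expansion[symmetric] supported_tail ord_ge_letter[simplified]\<close>)

lemma subst_cong: "(\<And>i. i < r \<Longrightarrow> p i = q i) \<Longrightarrow> subst r p f = subst r q f"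
proof -
  assume eq: "\<And>i. i < r \<Longrightarrow> p i = q i"
  have "subst_approx r p n f = subst_approx r q n f" for n f
    using eq by (induction n arbitrary: f) (auto intro!: sum.cong)
  then show ?thesis by (simp add: subst_def del: subst_approx.simps)
qed

lemma supported_subst:
  assumes "\<And>i. i < s \<Longrightarrow> supported r (p i)" shows "supported r (subst s p f)"
proof -
  have "supported r (subst_approx s p n f)" for n f
    by (induction n arbitrary: f)
      (auto intro!: supported_add supported_scale supported_sum supported_mult assms)
  then show ?thesis by (simp add: supported_def subst_def del: subst_approx.simps)
qed

lemma integral_subst:
  assumes "\<And>i. i < s \<Longrightarrow> integral_series (p i)" "integral_series f"
  shows "integral_series (subst s p f)"
proof -
  have "integral_series (subst_approx s p n f)" for n
    using assms(2)
    by (induction n arbitrary: f)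
      (auto intro!: integral_add integral_scale integral_sum integral_mult assms(1) integral_tail,
        auto simp: integral_series_def)
  then show ?thesis by (simp add: integral_series_def subst_def del: subst_approx.simps)
qed

lemma ord_ge_subst:
  assumes p: "\<And>i. i < r \<Longrightarrow> ord_ge 1 (p i)"
  shows "ord_ge n f \<Longrightarrow> ord_ge n (subst r p f)"
proof (induction n arbitrary: f)
  case (Suc n)
  then have "wcoeff f [] = 0" "\<And>i. ord_ge n (tail i f)" by (simp_all add: ord_ge_Suc_iff)
  then have "subst r p f = (\<Sum>i<r. p i * subst r p (tail i f))"
    by (subst subst_rec[OF p]) simp_all
  moreover have "ord_ge (1 + n) \<dots>"
    by (intro ord_ge_sum ord_ge_mult p Suc) (simp_all add: \<open>\<And>i. ord_ge n (tail i f)\<close>)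
  ultimately show ?case by simp
qed simp

section \<open>Linear substitutions\<close>

definition linear_form :: "ncseries \<Rightarrow> bool" where
  "linear_form p \<longleftrightarrow> hom_part 1 p = p"

lemma linear_form_hom_part: "linear_form (hom_part 1 f)"
  by (auto simp: linear_form_def wcoeff_hom_part intro!: ncseries_eqI)

lemma linear_formD: "linear_form p \<Longrightarrow> length w \<noteq> 1 \<Longrightarrow> wcoeff p w = 0"
  unfolding linear_form_def by (metis wcoeff_hom_part)

lemma ord_ge_linear_form: "linear_form p \<Longrightarrow> ord_ge 1 p"
  using linear_formD by (auto simp: ord_ge_def)

lemma wcoeff_linear_form_mult:
  assumes "linear_form p" shows "wcoeff (p * g) (a # w) = wcoeff p [a] * wcoeff g w"
proof -
  have "tail a p = scale (wcoeff p [a]) 1"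
    using linear_formD[OF assms] by (auto intro!: ncseries_eqI simp: wcoeff_one)
  then show ?thesis using linear_formD[OF assms] by (simp add: wcoeff_mult_Cons scale_mult_left)
qed

lemma wcoeff_subst_Nil:
  assumes "\<And>i. i < r \<Longrightarrow> ord_ge 1 (p i)" shows "wcoeff (subst r p f) [] = wcoeff f []"
proof -
  have "wcoeff (p i) [] = 0" if "i < r" for i using assms[OF that] by (simp add: ord_ge_def)
  then show ?thesis by (subst subst_rec[OF assms]) (simp_all add: wcoeff_one)
qed

lemma wcoeff_subst_linear_Cons:
  assumes "\<And>i. i < r \<Longrightarrow> linear_form (p i)"
  shows "wcoeff (subst r p f) (a # w) = (\<Sum>i<r. wcoeff (p i) [a] * wcoeff (subst r p (tail i f)) w)"
  by (subst subst_rec)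
    (simp_all add: assms ord_ge_linear_form[OF assms, simplified] wcoeff_one wcoeff_linear_form_mult)

lemma hom_part_subst_linear:
  assumes p: "\<And>i. i < r \<Longrightarrow> linear_form (p i)"
  shows "hom_part n (subst r p f) = subst r p (hom_part n f)"
proof -
  have p1: "\<And>i. i < r \<Longrightarrow> ord_ge 1 (p i)" using p ord_ge_linear_form by blast
  have "wcoeff (subst r p (hom_part n f)) w = (if length w = n then wcoeff (subst r p f) w else 0)" for w
  proof (induction w arbitrary: n f)
    case (Cons a w)
    show ?case
    proof (cases n)
      case 0
      then have "tail i (hom_part n f) = 0" for i by (auto intro!: ncseries_eqI simp: wcoeff_hom_part)
      then show ?thesis using 0 by (simp add: wcoeff_subst_linear_Cons[OF p])
    next
      case (Suc m)
      then have "tail i (hom_part n f) = hom_part m (tail i f)" for i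
        by (auto intro!: ncseries_eqI simp: wcoeff_hom_part)
      then show ?thesis using Suc Cons by (simp add: wcoeff_subst_linear_Cons[OF p])
    qed
  qed (simp add: wcoeff_subst_Nil[OF p1] wcoeff_hom_part)
  then show ?thesis by (auto intro!: ncseries_eqI simp: wcoeff_hom_part)
qed

text \<open>
  Each of the \<open>n\<close> or more letters in a word of \<open>f\<close> contributes degree at least one, and contributes
  exactly one only through the linear part of the series substituted for it.
\<close>
lemma ord_ge_subst_linear_part:
  assumes p: "\<And>i. i < r \<Longrightarrow> ord_ge 1 (p i)"
  shows "ord_ge n f \<Longrightarrow> ord_ge (Suc n) (subst r p f - subst r (\<lambda>i. hom_part 1 (p i)) f)"
proof (induction n arbitrary: f)
  case 0
  have "wcoeff (subst r (\<lambda>i. hom_part 1 (p i)) f) [] = wcoeff f []"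
    by (rule wcoeff_subst_Nil) (rule ord_ge_linear_form[OF linear_form_hom_part])
  then show ?case using wcoeff_subst_Nil[of r p f, OF p] by (simp add: ord_ge_def)
next
  case (Suc n)
  let ?q = "\<lambda>i. hom_part 1 (p i)"
  have q: "ord_ge 1 (?q i)" for i by (rule ord_ge_hom_part)
  have t: "ord_ge n (tail i f)" for i using Suc.prems by (simp add: ord_ge_Suc_iff)
  have "subst r p f - subst r ?q f
    = (\<Sum>i<r. p i * (subst r p (tail i f) - subst r ?q (tail i f)) + (p i - ?q i) * subst r ?q (tail i f))"
    by (subst subst_rec[OF p], simp, subst subst_rec[OF q])
      (simp add: sum_subtractf algebra_simps flip: sum.distrib)
  moreover have "ord_ge (1 + Suc n) (p i * (subst r p (tail i f) - subst r ?q (tail i f)))" if "i < r" for i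
    by (intro ord_ge_mult p that Suc.IH t)
  moreover have "ord_ge (2 + n) ((p i - ?q i) * subst r ?q (tail i f))" if "i < r" for i
    using ord_ge_mult[OF ord_ge_diff_hom_part[OF p[OF that]] ord_ge_subst[of r ?q, OF q t[of i]]] by simp
  ultimately show ?case by (auto intro!: ord_ge_sum ord_ge_add)
qed

text \<open>
  A substitution acts on leading terms through its linear part; this is what makes twisted
  conjugacy accessible to linear algebra.
\<close>
lemma hom_part_subst:
  assumes p: "\<And>i. i < r \<Longrightarrow> ord_ge 1 (p i)" and "ord_ge n f"
  shows "hom_part n (subst r p f) = subst r (\<lambda>i. hom_part 1 (p i)) (hom_part n f)"
  using hom_part_eq[OF ord_ge_subst_linear_part[OF assms]]
  by (simp only: hom_part_subst_linear linear_form_hom_part)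

section \<open>Lie elements\<close>

definition bracket :: "ncseries \<Rightarrow> ncseries \<Rightarrow> ncseries" where
  "bracket f g = f * g - g * f"

lemma bracket_add_left: "bracket (f + g) h = bracket f h + bracket g h"
  and bracket_zero [simp]: "bracket 0 h = 0" "bracket h 0 = 0"
  by (simp_all add: bracket_def algebra_simps)

lemma bracket_scale_left: "bracket (scale c f) g = scale c (bracket f g)"
  and bracket_scale_right: "bracket g (scale c f) = scale c (bracket g f)"
  by (simp_all add: bracket_def scale_mult_left scale_mult_right series.scale_right_diff_distrib)

lemma bracket_sum_right: "bracket f (\<Sum>i\<in>I. g i) = (\<Sum>i\<in>I. bracket f (g i))"
  by (simp add: bracket_def sum_distrib_left sum_distrib_right sum_subtractf)

text \<open>
  The value at the empty word is a dummy.
\<close>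
fun left_normed :: "(nat \<Rightarrow> ncseries) \<Rightarrow> nat list \<Rightarrow> ncseries" where
  "left_normed p [] = 0"
| "left_normed p (i # w) = foldl (\<lambda>f j. bracket f (p j)) (p i) w"

lemma left_normed_snoc:
  "w \<noteq> [] \<Longrightarrow> left_normed p (w @ [j]) = bracket (left_normed p w) (p j)"
  by (cases w) simp_all

definition words :: "nat \<Rightarrow> nat \<Rightarrow> nat list set" where
  "words r n = {w. length w = n \<and> set w \<subseteq> {..<r}}"

lemma finite_words [simp]: "finite (words r n)"
  using finite_lists_length_eq[of "{..<r}" n] by (simp add: words_def conj_commute)

text \<open>
  By the Jacobi identity these are all Lie polynomials of degree \<open>n\<close> over the complex numbers.
\<close>
definition lie :: "nat \<Rightarrow> nat \<Rightarrow> ncseries set" where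
  "lie r n = series.span (left_normed letter ` words r n)"

lemma wcoeff_letter_combination:
  "wcoeff (\<Sum>i<n. scale (c i) (letter i)) w = (if length w = 1 \<and> hd w < n then c (hd w) else 0)"
proof (cases "length w = 1")
  case True
  then obtain j where j: "w = [j]" by (auto simp: length_Suc_conv)
  have "wcoeff (\<Sum>i<n. scale (c i) (letter i)) w = (\<Sum>i<n. if i = j then c i else 0)"
    unfolding wcoeff_sum by (intro sum.cong) (auto simp: j wcoeff_letter)
  then show ?thesis using j by simp
next
  case False
  then show ?thesis unfolding wcoeff_sum by (auto simp: wcoeff_letter intro!: sum.neutral)
qed

lemma linear_form_expansion:
  assumes "linear_form g" "supported r g"
  shows "g = (\<Sum>i<r. scale (wcoeff g [i]) (letter i))"
proof (rule ncseries_eqI)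
  fix w
  show "wcoeff g w = wcoeff (\<Sum>i<r. scale (wcoeff g [i]) (letter i)) w"
  proof (cases "length w = 1")
    case True
    then obtain j where j: "w = [j]" by (auto simp: length_Suc_conv)
    have "wcoeff g [j] = 0" if "\<not> j < r" using assms(2) that by (simp add: supported_def)
    then show ?thesis by (simp add: wcoeff_letter_combination j del: wcoeff_sum)
  next
    case False
    then show ?thesis using linear_formD[OF assms(1)] by (simp add: wcoeff_letter_combination del: wcoeff_sum)
  qed
qed

lemma left_normed_letter_in_lie: "w \<in> words r n \<Longrightarrow> left_normed letter w \<in> lie r n"
  unfolding lie_def by (auto intro: series.span_base)

lemma subspace_lie: "series.subspace (lie r n)"
  by (simp add: lie_def)

lemma bracket_in_lie:
  assumes f: "f \<in> lie r n" and "0 < n" and g: "linear_form g" "supported r g"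
  shows "bracket f g \<in> lie r (Suc n)"
proof -
  have 1: "bracket f (letter i) \<in> lie r (Suc n)" if "i < r" for i
    using f unfolding lie_def[of r n]
  proof (induction rule: series.span_induct_alt)
    case base
    then show ?case by (simp add: series.subspace_0[OF subspace_lie])
  next
    case (step c x y)
    then obtain w where w: "x = left_normed letter w" "w \<in> words r n" by auto
    then have "bracket x (letter i) = left_normed letter (w @ [i])"
      using \<open>0 < n\<close> by (subst left_normed_snoc) (auto simp: words_def)
    moreover have "w @ [i] \<in> words r (Suc n)" using w(2) that by (simp add: words_def)
    ultimately have "bracket x (letter i) \<in> lie r (Suc n)" using left_normed_letter_in_lie by simp
    then show ?case using step
      by (simp add: bracket_add_left bracket_scale_left series.subspace_add series.subspace_scale
          subspace_lie)
  qed
  have "bracket f g = (\<Sum>i<r. scale (wcoeff g [i]) (bracket f (letter i)))"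
    by (subst linear_form_expansion[OF g]) (simp add: bracket_sum_right bracket_scale_right)
  also have "\<dots> \<in> lie r (Suc n)"
    by (intro series.subspace_sum series.subspace_scale subspace_lie 1) simp
  finally show ?thesis .
qed

lemma linear_form_in_lie:
  assumes g: "linear_form g" "supported r g" shows "g \<in> lie r 1"
proof -
  have "letter i \<in> lie r 1" if "i < r" for i
    using left_normed_letter_in_lie[of "[i]" r 1] that by (simp add: words_def)
  then have "(\<Sum>i<r. scale (wcoeff g [i]) (letter i)) \<in> lie r 1"
    by (intro series.subspace_sum series.subspace_scale subspace_lie) simp
  then show ?thesis using linear_form_expansion[OF g] by simp
qed

lemma left_normed_in_lie:
  assumes p: "\<And>i. i < r \<Longrightarrow> linear_form (p i)" "\<And>i. i < r \<Longrightarrow> supported r (p i)"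
    and w: "w \<noteq> []" "set w \<subseteq> {..<r}"
  shows "left_normed p w \<in> lie r (length w)"
  using w
proof (induction w rule: rev_induct)
  case (snoc j w)
  show ?case
  proof (cases "w = []")
    case True
    then show ?thesis using snoc.prems p linear_form_in_lie[of "p j" r] by simp
  next
    case False
    then show ?thesis
      using snoc p bracket_in_lie[of "left_normed p w" r "length w" "p j"]
      by (simp add: left_normed_snoc)
  qed
qed simp

lemma subst_left_normed:
  assumes p: "\<And>i. i < r \<Longrightarrow> ord_ge 1 (p i)" and w: "set w \<subseteq> {..<r}"
  shows "subst r p (left_normed letter w) = left_normed p w"
  using w
proof (induction w rule: rev_induct)
  case (snoc j w)
  show ?case
  proof (cases "w = []")
    case True
    then show ?thesis using snoc.prems p by (simp add: subst_letter)
  next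
    case False
    then show ?thesis using snoc p
      by (simp add: left_normed_snoc bracket_def subst.diff subst_mult subst_letter)
  qed
qed simp

text \<open>
  A linear substitution turns a left-normed bracket of letters into a left-normed bracket of linear
  forms, which expands multilinearly.
\<close>
lemma subst_in_lie:
  assumes p: "\<And>i. i < r \<Longrightarrow> linear_form (p i)" "\<And>i. i < r \<Longrightarrow> supported r (p i)"
    and f: "f \<in> lie r n" "0 < n"
  shows "subst r p f \<in> lie r n"
  using f(1) unfolding lie_def[of r n]
proof (induction rule: series.span_induct_alt)
  case base
  then show ?case by (simp add: series.span_zero)
next
  case (step c x y)
  then obtain w where w: "x = left_normed letter w" "w \<in> words r n" by auto
  then have "subst r p x = left_normed p w"
    using subst_left_normed[of r p w] p(1) ord_ge_linear_form by (auto simp: words_def)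
  moreover have "left_normed p w \<in> lie r n"
    using left_normed_in_lie[of r p w, OF p] w(2) f(2) by (auto simp: words_def)
  ultimately show ?case using step
    by (simp add: subst_add subst_scale series.span_add series.span_scale lie_def)
qed

lemma supported_left_normed_letter: "set w \<subseteq> {..<r} \<Longrightarrow> supported r (left_normed letter w)"
proof (induction w rule: rev_induct)
  case (snoc j w)
  then show ?case
    by (cases "w = []") (simp_all add: left_normed_snoc bracket_def supported_diff supported_mult
        supported_letter)
qed simp

lemma supported_subspace: "series.subspace {f. supported r f}"
  by (rule series.subspaceI) (auto intro: supported_add supported_scale)

lemma supported_lie: "f \<in> lie r n \<Longrightarrow> supported r f"
  using series.span_minimal[OF _ supported_subspace, of "left_normed letter ` words r n" r]
    supported_left_normed_letter
  by (auto simp: lie_def words_def)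

text \<open>
  The two products in a bracket only permute the letters, so \<open>left_normed\<close> is homogeneous in each
  variable separately.
\<close>
lemma mset_left_normed_letter:
  "wcoeff (left_normed letter w) v \<noteq> 0 \<Longrightarrow> mset v = mset w"
proof (induction w arbitrary: v rule: rev_induct)
  case (snoc j w)
  show ?case
  proof (cases "w = []")
    case True
    then show ?thesis using snoc.prems by (auto simp: wcoeff_letter split: if_splits)
  next
    case False
    let ?f = "left_normed letter w"
    have "wcoeff (?f * letter j) v \<noteq> 0 \<or> wcoeff (letter j * ?f) v \<noteq> 0"
      using snoc.prems False by (auto simp: left_normed_snoc bracket_def)
    then show ?thesis
    proof
      assume "wcoeff (?f * letter j) v \<noteq> 0"
      then show ?thesis using snoc.IH
        by (cases v rule: rev_cases) (auto simp: wcoeff_mult_letter_snoc wcoeff_letter split: if_splits)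
    next
      assume "wcoeff (letter j * ?f) v \<noteq> 0"
      then show ?thesis using snoc.IH
        by (cases v) (auto simp: wcoeff_letter_mult_Cons wcoeff_letter split: if_splits)
    qed
  qed
qed simp

text \<open>
  A word beginning with \<open>a\<close> can arise only if every later letter is multiplied on the right,
  because multiplication on the left by \<open>j \<noteq> a\<close> puts \<open>j\<close> in front.
\<close>
lemma left_normed_leading:
  "a \<notin> set w \<Longrightarrow> wcoeff (left_normed letter (a # w)) (a # w) = 1"
proof (induction w rule: rev_induct)
  case (snoc j w)
  then have "left_normed letter (a # w @ [j]) = bracket (left_normed letter (a # w)) (letter j)"
    using left_normed_snoc[of "a # w" letter j] by simp
  then show ?case
    using snoc wcoeff_mult_letter_snoc[of "left_normed letter (a # w)" j "a # w" j]
    by (simp add: bracket_def wcoeff_letter_mult_Cons del: left_normed.simps)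
qed (simp add: wcoeff_letter)

text \<open>
  Closing the bracket with a second \<open>a\<close> gives \<open>P a - a P\<close>.  The word \<open>a a w\<close> does not occur in \<open>P a\<close>,
  since \<open>w\<close> does not end with \<open>a\<close>, and its coefficient in \<open>a P\<close> is that of \<open>a w\<close> in \<open>P\<close>.
\<close>
lemma left_normed_repeated:
  assumes "a \<notin> set w" "w \<noteq> []"
  shows "wcoeff (left_normed letter (a # w @ [a])) (a # a # w) = -1"
proof -
  obtain v b where w: "w = v @ [b]" "b \<noteq> a" using assms by (cases w rule: rev_cases) auto
  have "left_normed letter (a # w @ [a]) = bracket (left_normed letter (a # w)) (letter a)"
    using left_normed_snoc[of "a # w" letter a] by simp
  then show ?thesis
    using left_normed_leading[OF assms(1)] w(2)
      wcoeff_mult_letter_snoc[of "left_normed letter (a # w)" a "a # a # v" b]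
    by (simp add: bracket_def wcoeff_letter_mult_Cons w(1) del: left_normed.simps)
qed

section \<open>Fixed Lie elements of triangular substitutions\<close>

text \<open>
  A triangular substitution replaces each letter of a word by letters with at most the same index.
  Hence a word \<open>w\<close> receives contributions only from itself and from words with a larger index sum,
  where \<open>f\<close> is assumed to vanish.
\<close>
lemma wcoeff_subst_triangular:
  assumes p: "\<And>i. i < r \<Longrightarrow> linear_form (p i)"
    and tri: "\<And>i a. i < r \<Longrightarrow> i < a \<Longrightarrow> wcoeff (p i) [a] = 0"
    and f: "\<And>v. length v = length w \<Longrightarrow> sum_list w < sum_list v \<Longrightarrow> wcoeff f v = 0"
    and w: "set w \<subseteq> {..<r}"
  shows "wcoeff (subst r p f) w = (\<Prod>a\<leftarrow>w. wcoeff (p a) [a]) * wcoeff f w"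
  using f w
proof (induction w arbitrary: f)
  case Nil
  then show ?case using wcoeff_subst_Nil[of r p f] p ord_ge_linear_form by simp
next
  case (Cons a w)
  have "wcoeff (p i) [a] * wcoeff (subst r p (tail i f)) w =
      (if i = a then (\<Prod>a\<leftarrow>a # w. wcoeff (p a) [a]) * wcoeff f (a # w) else 0)" if "i < r" for i
  proof (cases "i < a")
    case True
    then show ?thesis using tri[OF that] by simp
  next
    case False
    have "wcoeff (subst r p (tail i f)) w = (\<Prod>a\<leftarrow>w. wcoeff (p a) [a]) * wcoeff (tail i f) w"
      using Cons.prems False by (intro Cons.IH) simp_all
    moreover have "wcoeff f (i # w) = 0" if "i \<noteq> a"
      using Cons.prems(1)[of "i # w"] False that by simp
    ultimately show ?thesis by simp
  qed
  then have "wcoeff (subst r p f) (a # w)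
      = (\<Sum>i<r. if i = a then (\<Prod>a\<leftarrow>a # w. wcoeff (p a) [a]) * wcoeff f (a # w) else 0)"
    by (subst wcoeff_subst_linear_Cons[OF p]) auto
  then show ?case using Cons.prems(2) by simp
qed

lemma prod_list_mset_cong: "mset v = mset w \<Longrightarrow> (\<Prod>a\<leftarrow>v. g a) = (\<Prod>a\<leftarrow>w. g a :: complex)"
  by (metis mset_map prod_mset_prod_list)

lemma sum_list_mset_cong: "mset v = mset w \<Longrightarrow> sum_list v = (sum_list w :: nat)"
  by (metis sum_mset_sum_list)
text \<open>
  The left-normed bracket \<open>u\<close> with every variable occurring twice is fixed only up to words of smaller
  index sum, on which \<open>p\<close> may have any eigenvalues, so it cannot be corrected to a fixed vector step by
  step.  Existence is therefore argued by dimension: were \<open>D = subst r p - 1\<close> injective, it would map the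
  space \<open>F\<close> of Lie elements of smaller index sum onto itself, and \<open>D u \<in> F\<close> would force \<open>u \<in> F\<close>.
\<close>
lemma triangular_fixed_lie_element:
  assumes r: "r \<ge> 2"
    and p: "\<And>i. i < r \<Longrightarrow> linear_form (p i)" "\<And>i. i < r \<Longrightarrow> supported r (p i)"
    and tri: "\<And>i a. i < r \<Longrightarrow> i < a \<Longrightarrow> wcoeff (p i) [a] = 0"
    and det: "(\<Prod>i<r. wcoeff (p i) [i])\<^sup>2 = 1"
  shows "\<exists>g\<in>lie r (2 * r). g \<noteq> 0 \<and> subst r p g = g"
proof (rule ccontr)
  assume no: "\<not> ?thesis"
  define D where "D = (\<lambda>f. subst r p f - f)"
  \<comment> \<open>The word \<open>0 # ys @ [0]\<close> contains every letter twice, and \<open>ys\<close> avoids \<open>0\<close>, so that \<open>left_normed_repeated\<close> applies.\<close>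
  define ys where "ys = concat (map (\<lambda>i. [i, i]) [1..<r])"
  define u where "u = left_normed letter (0 # ys @ [0])"
  define s where "s = sum_list ys"
  define F where "F = lie r (2 * r) \<inter> {f. \<forall>v. s \<le> sum_list v \<longrightarrow> wcoeff f v = 0}"
  have ys: "0 \<notin> set ys" "set ys \<subseteq> {..<r}" "ys \<noteq> []" "length ys + 2 = 2 * r"
  proof -
    have "length (concat (map (\<lambda>i. [i, i]) xs)) = 2 * length xs" for xs :: "nat list"
      by (induction xs) simp_all
    then have "length ys = 2 * (r - 1)" unfolding ys_def by simp
    then have "length ys + 2 = 2 * r" using r by linarith
    then show "0 \<notin> set ys" "set ys \<subseteq> {..<r}" "ys \<noteq> []" "length ys + 2 = 2 * r"
      using r by (auto simp: ys_def)
  qed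
  have prod_ys: "(\<Prod>a\<leftarrow>0 # ys @ [0]. d a) = (\<Prod>i<r. d i)\<^sup>2" for d :: "nat \<Rightarrow> complex"
  proof -
    have twice: "(\<Prod>a\<leftarrow>concat (map (\<lambda>i. [i, i]) xs). d a) = (\<Prod>a\<leftarrow>xs. d a)\<^sup>2" for xs
      by (induction xs) (simp_all add: power2_eq_square mult_ac)
    have "(\<Prod>i<r. d i) = (\<Prod>a\<leftarrow>[0..<r]. d a)"
      using prod.distinct_set_conv_list[of "[0..<r]" d] by (simp add: atLeast0LessThan)
    also have "[0..<r] = 0 # [1..<r]" using r by (simp add: upt_conv_Cons)
    finally show ?thesis by (simp add: ys_def twice power2_eq_square mult_ac)
  qed
  have linD: "Vector_Spaces.linear scale scale D"
    by unfold_locales (simp_all add: D_def subst_add subst_scale series.scale_right_diff_distrib)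
  interpret D: Vector_Spaces.linear scale scale D by (rule linD)
  have D_lie: "D f \<in> lie r (2 * r)" if "f \<in> lie r (2 * r)" for f
    unfolding D_def using that r subst_in_lie[of r p f "2 * r", OF p]
    by (intro series.subspace_diff subspace_lie) simp_all
  have inj: "inj_on D (lie r (2 * r))"
  proof -
    have "f = 0" if "f \<in> lie r (2 * r)" "D f = 0" for f
    proof -
      have "subst r p f = f" using that(2) unfolding D_def by simp
      then show ?thesis using no that(1) by blast
    qed
    then show ?thesis using D.inj_on_iff_eq_0[OF subspace_lie] by blast
  qed
  have sub_F: "series.subspace F"
    unfolding F_def
    by (rule series.subspace_inter[OF subspace_lie], rule series.subspaceI) auto
  \<comment> \<open>On words of maximal index sum, \<open>D\<close> acts diagonally.\<close>
  have D_coeff: "wcoeff (D f) w = ((\<Prod>a\<leftarrow>w. wcoeff (p a) [a]) - 1) * wcoeff f w"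
    if "f \<in> lie r (2 * r)" "\<And>v. sum_list w < sum_list v \<Longrightarrow> wcoeff f v = 0" for f w
  proof (cases "set w \<subseteq> {..<r}")
    case True
    have "wcoeff (subst r p f) w = (\<Prod>a\<leftarrow>w. wcoeff (p a) [a]) * wcoeff f w"
      by (rule wcoeff_subst_triangular) (use p(1) tri that(2) True in \<open>blast+\<close>)
    then show ?thesis by (simp add: D_def left_diff_distrib)
  next
    case False
    have "supported r f" using supported_lie[OF that(1)] .
    moreover have "supported r (D f)" using supported_lie[OF D_lie[OF that(1)]] .
    ultimately show ?thesis using False unfolding supported_def by (metis mult_zero_right)
  qed
  have "inj_on D F" by (rule inj_on_subset[OF inj]) (simp add: F_def)
  moreover have "D ` F \<subseteq> F"
  proof
    fix g assume "g \<in> D ` F"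
    then obtain f where f: "f \<in> F" "g = D f" by auto
    then have f_lie: "f \<in> lie r (2 * r)" and f_s: "\<And>v. s \<le> sum_list v \<Longrightarrow> wcoeff f v = 0"
      unfolding F_def by blast+
    have "wcoeff (D f) v = 0" if "s \<le> sum_list v" for v
      using D_coeff[OF f_lie, of v] f_s that by simp
    then show "g \<in> F" using f(2) D_lie[OF f_lie] unfolding F_def by blast
  qed
  moreover have "F \<subseteq> series.span (left_normed letter ` words r (2 * r))"
    by (auto simp: F_def lie_def)
  ultimately have surj: "F \<subseteq> D ` F"
    using series.finite_dim_inj_on_iff_surj_on[OF linD sub_F _ finite_imageI[OF finite_words]]
    by metis
  \<comment> \<open>Every word of \<open>u\<close> has index sum \<open>s\<close> and diagonal product \<open>(\<Prod>i<r. wcoeff (p i) [i])\<^sup>2 = 1\<close>.\<close>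
  have u: "u \<in> lie r (2 * r)"
    unfolding u_def using ys r by (intro left_normed_letter_in_lie) (auto simp: words_def)
  have u_mset: "mset v = mset (0 # ys @ [0])" if "wcoeff u v \<noteq> 0" for v
    using that mset_left_normed_letter unfolding u_def by blast
  have u_sum: "sum_list v = s" if "wcoeff u v \<noteq> 0" for v
    using sum_list_mset_cong[OF u_mset[OF that]] by (simp add: s_def)
  have "wcoeff (D u) v = 0" if "s \<le> sum_list v" for v
  proof -
    have "wcoeff (D u) v = ((\<Prod>a\<leftarrow>v. wcoeff (p a) [a]) - 1) * wcoeff u v"
    proof (rule D_coeff[OF u])
      fix v' assume "sum_list v < sum_list v'"
      then show "wcoeff u v' = 0" using u_sum[of v'] that by force
    qed
    moreover have "(\<Prod>a\<leftarrow>v. wcoeff (p a) [a]) = 1" if "wcoeff u v \<noteq> 0"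
      by (rule trans[OF prod_list_mset_cong[OF u_mset[OF that]] trans[OF prod_ys det]])
    ultimately show ?thesis by auto
  qed
  then have "D u \<in> F" using D_lie[OF u] by (simp add: F_def)
  then obtain u' where u': "u' \<in> F" "D u = D u'" using surj by blast
  have "u' \<in> lie r (2 * r)" using u'(1) unfolding F_def by blast
  then have "u = u'" by (rule inj_onD[OF inj u'(2) u])
  then have "wcoeff u (0 # 0 # ys) = 0" using u'(1) by (simp add: F_def s_def)
  then show False using left_normed_repeated[OF ys(1,3)] by (simp add: u_def)
qed

section \<open>Fixed Lie elements of matrices of determinant one or minus one\<close>

text \<open>
  The image of the \<open>i\<close>-th variable under the matrix \<open>A\<close>, which acts on column vectors.
\<close>
definition column_form :: "complex mat \<Rightarrow> nat \<Rightarrow> ncseries" where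
  "column_form A i = (\<Sum>j<dim_row A. scale (A $$ (j, i)) (letter j))"

lemma linear_form_column_form: "linear_form (column_form A i)"
  unfolding linear_form_def column_form_def
  by (rule ncseries_eqI) (simp add: wcoeff_hom_part wcoeff_letter_combination del: wcoeff_sum)

lemma supported_column_form: "A \<in> carrier_mat r r \<Longrightarrow> supported r (column_form A i)"
  by (auto simp: column_form_def intro!: supported_sum supported_scale supported_letter)

lemma wcoeff_column_form: "a < dim_row A \<Longrightarrow> wcoeff (column_form A i) [a] = A $$ (a, i)"
  by (simp add: column_form_def wcoeff_letter_combination del: wcoeff_sum)

lemma column_form_mult:
  assumes "S \<in> carrier_mat r r" "T \<in> carrier_mat r r" "i < r"
  shows "column_form (S * T) i = subst r (column_form S) (column_form T i)"
proof -
  have ord: "ord_ge 1 (column_form Z i)" for Z i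
    by (rule ord_ge_linear_form[OF linear_form_column_form])
  have "subst r (column_form S) (column_form T i)
      = (\<Sum>j<r. scale (T $$ (j, i)) (column_form S j))"
    using assms by (simp add: column_form_def[of T] subst.sum subst_scale subst_letter[OF ord])
  also have "\<dots> = (\<Sum>k<r. \<Sum>j<r. scale (S $$ (k, j) * T $$ (j, i)) (letter k))"
    using assms by (subst sum.swap) (simp add: column_form_def series.scale_sum_right mult.commute)
  also have "\<dots> = column_form (S * T) i"
    using assms
    by (simp add: column_form_def scalar_prod_def series.scale_sum_left atLeast0LessThan)
  finally show ?thesis by simp
qed

lemma subst_column_form_mult:
  assumes "S \<in> carrier_mat r r" "T \<in> carrier_mat r r"
  shows "subst r (column_form (S * T)) f = subst r (column_form S) (subst r (column_form T) f)"
proof -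
  have ord: "ord_ge 1 (column_form Z i)" for Z i
    by (rule ord_ge_linear_form[OF linear_form_column_form])
  have "subst r (column_form (S * T)) f = subst r (\<lambda>i. subst r (column_form S) (column_form T i)) f"
    by (rule subst_cong) (rule column_form_mult[OF assms])
  also have "\<dots> = subst r (column_form S) (subst r (column_form T) f)"
    by (rule subst_subst) (simp_all only: ord ord_ge_subst)
  finally show ?thesis .
qed

lemma subst_column_form_one:
  assumes "supported r f" shows "subst r (column_form (1\<^sub>m r)) f = f"
proof -
  have "column_form (1\<^sub>m r) i = letter i" if "i < r" for i
  proof -
    have "column_form (1\<^sub>m r) i = (\<Sum>j<r. if j = i then letter j else 0)"
      unfolding column_form_def using that by (intro sum.cong) auto
    then show ?thesis using that by simp
  qed
  then have "subst r (column_form (1\<^sub>m r)) f = subst r letter f" by (rule subst_cong)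
  then show ?thesis using subst_letters[OF assms] by simp
qed

text \<open>
  Lie elements are preserved by all linear substitutions, so the triangular case transfers along a
  Schur decomposition \<open>A = P B Q\<close> with \<open>Q = P\<^sup>-\<^sup>1\<close>.
\<close>
lemma fixed_lie_element:
  assumes r: "r \<ge> 2" and A: "A \<in> carrier_mat r r" and det: "(det A)\<^sup>2 = 1"
  shows "\<exists>f\<in>lie r (2 * r). f \<noteq> 0 \<and> subst r (column_form A) f = f"
proof -
  obtain es where es: "char_poly A = (\<Prod>e\<leftarrow>es. [:- e, 1:])"
    using char_poly_factorized[OF A] by blast
  obtain B P Q where "schur_decomposition A es = (B, P, Q)" by (metis prod_cases3)
  then have sim: "similar_mat_wit A B P Q" and up: "upper_triangular B"
    using schur_decomposition[OF A es] by auto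
  have BPQ: "B \<in> carrier_mat r r" "P \<in> carrier_mat r r" "Q \<in> carrier_mat r r"
      "P * Q = 1\<^sub>m r" "Q * P = 1\<^sub>m r" "A = P * B * Q"
    using similar_mat_witD2[OF A sim] by auto
  have "det A = det B"
    using det_similar similar_mat_def sim by metis
  also have "\<dots> = (\<Prod>i<r. B $$ (i, i))"
    using det_upper_triangular[OF up BPQ(1)] BPQ(1) by (simp add: prod_list_diag_prod atLeast0LessThan)
  also have "\<dots> = (\<Prod>i<r. wcoeff (column_form B i) [i])"
    using BPQ(1) by (intro prod.cong) (simp_all add: wcoeff_column_form)
  finally have "(\<Prod>i<r. wcoeff (column_form B i) [i])\<^sup>2 = 1" using det by simp
  moreover have "wcoeff (column_form B i) [a] = 0" if "i < r" "i < a" for i a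
  proof (cases "a < r")
    case True
    then show ?thesis using up that BPQ(1) by (auto simp: wcoeff_column_form upper_triangular_def)
  next
    case False
    then show ?thesis using supported_column_form[OF BPQ(1)] by (simp add: supported_def)
  qed
  ultimately obtain g where g: "g \<in> lie r (2 * r)" "g \<noteq> 0" "subst r (column_form B) g = g"
    using triangular_fixed_lie_element[of r "column_form B"] r linear_form_column_form
      supported_column_form[OF BPQ(1)] by blast
  define f where "f = subst r (column_form P) g"
  have Qf: "subst r (column_form Q) f = g"
    using subst_column_form_mult[OF BPQ(3,2), of g] subst_column_form_one[OF supported_lie[OF g(1)]]
    by (simp add: f_def BPQ(5))
  have "subst r (column_form A) f = f"
    using subst_column_form_mult[of "P * B" r Q f] subst_column_form_mult[of P r B g] BPQ Qf g(3)
    by (simp add: f_def)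
  moreover have "f \<noteq> 0" using Qf g(2) by auto
  moreover have "f \<in> lie r (2 * r)"
    unfolding f_def using g(1) r
    by (intro subst_in_lie linear_form_column_form supported_column_form[OF BPQ(2)]) simp_all
  ultimately show ?thesis by blast
qed

section \<open>The Magnus group and its filtration\<close>

text \<open>
  Integral coefficients are needed for the determinant on the abelianization, and the restriction to finitely
  many letters makes the spaces of leading terms finite-dimensional.
\<close>
definition magnus_group :: "nat \<Rightarrow> ncseries monoid" where
  "magnus_group r =
     \<lparr>carrier = {f. wcoeff f [] = 1 \<and> supported r f \<and> integral_series f},
      monoid.mult = (*), monoid.one = 1\<rparr>"

lemma magnus_group_simps [simp]:
  "f \<otimes>\<^bsub>magnus_group r\<^esub> g = f * g" "\<one>\<^bsub>magnus_group r\<^esub> = 1"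
  by (simp_all add: magnus_group_def)

lemma in_magnus_group_iff:
  "f \<in> carrier (magnus_group r) \<longleftrightarrow> wcoeff f [] = 1 \<and> supported r f \<and> integral_series f"
  by (simp add: magnus_group_def)

lemma magnus_group_ord_ge: "f \<in> carrier (magnus_group r) \<Longrightarrow> ord_ge 1 (f - 1)"
  by (simp add: in_magnus_group_iff ord_ge_def wcoeff_one)

text \<open>
  Inverses of series with constant term \<open>1\<close> come from the inverse of \<open>1 - x\<^sub>0\<close> by the substitution
  \<open>x\<^sub>0 \<mapsto> 1 - f\<close>.
\<close>
definition geometric_series :: ncseries where
  "geometric_series = Series (\<lambda>w. if set w \<subseteq> {0} then 1 else 0)"

lemma geometric_series_inverse: "geometric_series * (1 - letter 0) = 1"
proof (rule ncseries_eqI)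
  fix w
  show "wcoeff (geometric_series * (1 - letter 0)) w = wcoeff 1 w"
    by (cases w rule: rev_cases)
      (simp_all add: right_diff_distrib wcoeff_mult_letter_snoc wcoeff_letter wcoeff_one
        geometric_series_def)
qed

lemma group_magnus_group: "group (magnus_group r)"
proof (rule groupI)
  fix f assume f: "f \<in> carrier (magnus_group r)"
  define g where "g = subst 1 (\<lambda>_. 1 - f) geometric_series"
  have ord: "ord_ge 1 (1 - f)" using ord_ge_uminus[OF magnus_group_ord_ge[OF f]] by simp
  have "subst 1 (\<lambda>_. 1 - f) (geometric_series * (1 - letter 0)) = g * f"
    by (simp add: g_def subst_mult ord subst.diff subst_one subst_letter ord[simplified])
  then have "g * f = 1"
    by (simp add: geometric_series_inverse subst_one ord[simplified])
  moreover have "g \<in> carrier (magnus_group r)"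
  proof -
    have "wcoeff g [] = 1"
      unfolding g_def using ord by (subst wcoeff_subst_Nil) (simp_all add: geometric_series_def)
    moreover have "supported r g"
      unfolding g_def using f
      by (intro supported_subst) (simp add: supported_diff in_magnus_group_iff)
    moreover have "integral_series geometric_series"
      by (simp add: geometric_series_def integral_series_def)
    then have "integral_series g"
      unfolding g_def using f
      by (intro integral_subst) (simp_all add: integral_diff in_magnus_group_iff)
    ultimately show ?thesis by (simp add: in_magnus_group_iff)
  qed
  ultimately show "\<exists>g\<in>carrier (magnus_group r). g \<otimes>\<^bsub>magnus_group r\<^esub> f = \<one>\<^bsub>magnus_group r\<^esub>"
    by auto
qed (auto simp: in_magnus_group_iff wcoeff_one mult.assoc supported_mult integral_mult)

interpretation magnus: group "magnus_group r" for r
  by (rule group_magnus_group)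

lemma magnus_inv:
  assumes "f \<in> carrier (magnus_group r)"
  shows "f * inv\<^bsub>magnus_group r\<^esub> f = 1" "inv\<^bsub>magnus_group r\<^esub> f * f = 1"
  using magnus.r_inv[OF assms] magnus.l_inv[OF assms] by simp_all
definition magnus_filtration :: "nat \<Rightarrow> nat \<Rightarrow> ncseries set" where
  "magnus_filtration r n = {f \<in> carrier (magnus_group r). ord_ge n (f - 1)}"

lemma ord_ge_mult_left: "ord_ge n f \<Longrightarrow> ord_ge n (f * g)"
  using ord_ge_mult[of n f 0 g] by simp

lemma ord_ge_mult_right: "ord_ge n g \<Longrightarrow> ord_ge n (f * g)"
  using ord_ge_mult[of 0 f n g] by simp

lemma subgroup_magnus_filtration: "subgroup (magnus_filtration r n) (magnus_group r)"
proof (rule magnus.subgroupI)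
  show "magnus_filtration r n \<noteq> {}"
    using magnus.one_closed[of r] by (auto simp: magnus_filtration_def intro!: exI[of _ 1])
next
  fix f assume "f \<in> magnus_filtration r n"
  then have f: "f \<in> carrier (magnus_group r)" "ord_ge n (f - 1)"
    by (simp_all add: magnus_filtration_def)
  let ?g = "inv\<^bsub>magnus_group r\<^esub> f"
  have "?g - 1 = - ((f - 1) * ?g)" using magnus_inv[OF f(1)] by (simp add: algebra_simps)
  then have "ord_ge n (?g - 1)" using f(2) by (simp add: ord_ge_uminus ord_ge_mult_left)
  then show "?g \<in> magnus_filtration r n" using f by (simp add: magnus_filtration_def)
next
  fix f g assume "f \<in> magnus_filtration r n" "g \<in> magnus_filtration r n"
  then have fg: "f \<in> carrier (magnus_group r)" "ord_ge n (f - 1)"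
      "g \<in> carrier (magnus_group r)" "ord_ge n (g - 1)"
    by (simp_all add: magnus_filtration_def)
  have eq: "f * g - 1 = (f - 1) * g + (g - 1)" by (simp add: algebra_simps)
  have "ord_ge n (f * g - 1)"
    unfolding eq using fg by (intro ord_ge_add ord_ge_mult_left)
  then show "f \<otimes>\<^bsub>magnus_group r\<^esub> g \<in> magnus_filtration r n"
    using fg magnus.m_closed[OF fg(1,3)] by (simp add: magnus_filtration_def)
qed (auto simp: magnus_filtration_def)

lemma commutator_minus_one:
  fixes f g f' g' :: ncseries
  assumes "f * f' = 1" "g * g' = 1"
  shows "f * g * f' * g' - 1 = bracket (f - 1) (g - 1) * (f' * g')"
proof -
  have "bracket (f - 1) (g - 1) * (f' * g') = f * g * f' * g' - g * (f * f') * g'"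
    by (simp add: bracket_def algebra_simps)
  then show ?thesis using assms by simp
qed

text \<open>
  Since \<open>[f, g] - 1 = (f g - g f) f\<^sup>-\<^sup>1 g\<^sup>-\<^sup>1\<close> and \<open>f g - g f\<close> is the Lie bracket of \<open>f - 1\<close> and \<open>g - 1\<close>,
  the order goes up by one and the lowest term is a Lie bracket.
\<close>
lemma commutator_in_magnus_filtration:
  assumes f: "f \<in> magnus_filtration r n" and g: "g \<in> carrier (magnus_group r)"
  shows "f * g * inv\<^bsub>magnus_group r\<^esub> f * inv\<^bsub>magnus_group r\<^esub> g \<in> magnus_filtration r (Suc n)"
    and "ord_ge (n + 2) (f * g * inv\<^bsub>magnus_group r\<^esub> f * inv\<^bsub>magnus_group r\<^esub> g - 1
            - bracket (f - 1) (g - 1))"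
proof -
  let ?f' = "inv\<^bsub>magnus_group r\<^esub> f" and ?g' = "inv\<^bsub>magnus_group r\<^esub> g"
  let ?b = "bracket (f - 1) (g - 1)"
  have fc: "f \<in> carrier (magnus_group r)" "ord_ge n (f - 1)"
    using f by (simp_all add: magnus_filtration_def)
  have c: "?f' \<in> carrier (magnus_group r)" "?g' \<in> carrier (magnus_group r)"
    using fc g by simp_all
  have eq: "f * g * ?f' * ?g' - 1 = ?b * (?f' * ?g')"
    using magnus_inv[OF fc(1)] magnus_inv[OF g] by (intro commutator_minus_one)
  have "ord_ge (n + 1) ((f - 1) * (g - 1))" "ord_ge (1 + n) ((g - 1) * (f - 1))"
    using fc(2) magnus_group_ord_ge[OF g] by (intro ord_ge_mult; simp)+
  then have b: "ord_ge (Suc n) ?b" by (simp add: bracket_def ord_ge_diff)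
  have "f * g * ?f' * ?g' \<in> carrier (magnus_group r)"
    using magnus.m_closed[OF magnus.m_closed[OF magnus.m_closed[OF fc(1) g] c(1)] c(2)] by simp
  then show "f * g * ?f' * ?g' \<in> magnus_filtration r (Suc n)"
    using b by (simp add: magnus_filtration_def eq ord_ge_mult_left)
  have "f * g * ?f' * ?g' - 1 - ?b = ?b * (?f' * ?g' - 1)"
    unfolding eq by (simp add: right_diff_distrib)
  moreover have "ord_ge 1 (?f' * ?g' - 1)"
    using magnus_group_ord_ge[OF magnus.m_closed[OF c]] by simp
  ultimately show "ord_ge (n + 2) (f * g * ?f' * ?g' - 1 - ?b)"
    using ord_ge_mult[OF b, of 1 "?f' * ?g' - 1"] by simp
qed

section \<open>Twisted conjugacy and leading terms\<close>

definition leading_terms :: "ncseries set \<Rightarrow> nat \<Rightarrow> ncseries set" where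
  "leading_terms S n = {hom_part n (x - 1) |x. x \<in> S \<and> ord_ge n (x - 1)}"

definition monomial :: "nat list \<Rightarrow> ncseries" where
  "monomial w = Series (\<lambda>v. if v = w then 1 else 0)"

lemma homogeneous_in_span_monomials:
  assumes "supported r f"
  shows "hom_part n f \<in> series.span (monomial ` words r n)"
proof -
  have "hom_part n f = (\<Sum>w\<in>words r n. scale (wcoeff f w) (monomial w))"
  proof (rule ncseries_eqI)
    fix v
    have "wcoeff (\<Sum>w\<in>words r n. scale (wcoeff f w) (monomial w)) v
        = (\<Sum>w\<in>words r n. if w = v then wcoeff f w else 0)"
      unfolding wcoeff_sum by (intro sum.cong) (auto simp: monomial_def)
    also have "\<dots> = (if v \<in> words r n then wcoeff f v else 0)" by simp
    finally show "wcoeff (hom_part n f) v = wcoeff (\<Sum>w\<in>words r n. scale (wcoeff f w) (monomial w)) v"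
      using assms by (auto simp: wcoeff_hom_part words_def supported_def)
  qed
  also have "\<dots> \<in> series.span (monomial ` words r n)"
    by (intro series.span_sum series.span_scale series.span_base) simp
  finally show ?thesis .
qed

text \<open>
  In \<open>x y - 1 = (x - 1) (y - 1) + (x - 1) + (y - 1)\<close> the product has order at least \<open>2 n > n\<close>, so leading
  terms of degree \<open>n\<close> add up.
\<close>
lemma magnus_pow_leading_term:
  assumes x: "x \<in> carrier (magnus_group r)" "ord_ge n (x - 1)" and n: "1 \<le> n"
  shows "ord_ge n (x [^]\<^bsub>magnus_group r\<^esub> (k :: nat) - 1)"
    and "hom_part n (x [^]\<^bsub>magnus_group r\<^esub> k - 1) = scale (of_nat k) (hom_part n (x - 1))"
proof -
  have "ord_ge n (x [^]\<^bsub>magnus_group r\<^esub> k - 1) \<and>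
    hom_part n (x [^]\<^bsub>magnus_group r\<^esub> k - 1) = scale (of_nat k) (hom_part n (x - 1))"
  proof (induction k)
    case (Suc k)
    let ?y = "x [^]\<^bsub>magnus_group r\<^esub> k"
    have eq: "x [^]\<^bsub>magnus_group r\<^esub> Suc k - 1 = (?y - 1) * (x - 1) + ((?y - 1) + (x - 1))"
      by (simp add: algebra_simps)
    have "ord_ge (n + n) ((?y - 1) * (x - 1))" using Suc x by (intro ord_ge_mult) simp_all
    then have o: "ord_ge (Suc n) ((?y - 1) * (x - 1))" by (rule ord_ge_mono) (use n in simp)
    then have "hom_part n ((?y - 1) * (x - 1)) = 0"
      using hom_part_eq[of n _ 0] by simp
    then have "hom_part n (x [^]\<^bsub>magnus_group r\<^esub> Suc k - 1) = scale (of_nat (Suc k)) (hom_part n (x - 1))"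
      unfolding eq using Suc
      by (simp only: hom_part_add) (simp add: series.scale_left_distrib add.commute)
    moreover have "ord_ge n (x [^]\<^bsub>magnus_group r\<^esub> Suc k - 1)"
      unfolding eq using Suc x ord_ge_mono[OF o] by (intro ord_ge_add) simp_all
    ultimately show ?case by simp
  qed simp
  then show "ord_ge n (x [^]\<^bsub>magnus_group r\<^esub> (k :: nat) - 1)"
    and "hom_part n (x [^]\<^bsub>magnus_group r\<^esub> k - 1) = scale (of_nat k) (hom_part n (x - 1))"
    by simp_all
qed

text \<open>
  The separating powers come from an element whose leading term is not of the form \<open>T m - m\<close>.  The
  least degree \<open>i\<close> with a fixed vector is used, because then a conjugating element \<open>y\<close> must lie in
  filtration step \<open>i\<close>: all its lower terms would be fixed vectors of \<open>T\<close>.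
\<close>
lemma infinitely_many_twisted_classes:
  assumes S: "subgroup S (magnus_group r)"
    and p: "\<And>i. i < r \<Longrightarrow> ord_ge 1 (p i)" and inv: "subst r p ` S \<subseteq> S"
    and T: "T = subst r (\<lambda>i. hom_part 1 (p i))"
    and n: "1 \<le> n" "n \<le> c" and f: "f \<in> series.span (leading_terms S n)" "f \<noteq> 0" "T f = f"
  shows "\<exists>x\<in>S. \<forall>k l :: nat. k \<noteq> l \<longrightarrow> \<not> (\<exists>y\<in>S.
    ord_ge (Suc c) (subst r p y * x [^]\<^bsub>magnus_group r\<^esub> k - x [^]\<^bsub>magnus_group r\<^esub> l * y))"
proof -
  let ?M = "magnus_group r"
  let ?K = "\<lambda>n. series.span (leading_terms S n)"
  \<comment> \<open>The assumed fixed vector need not have the least possible degree.\<close>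
  define bad where "bad = (\<lambda>n. 1 \<le> n \<and> (\<exists>f\<in>?K n. f \<noteq> 0 \<and> T f = f))"
  define i where "i = (LEAST n. bad n)"
  have "bad n" using n f by (auto simp: bad_def)
  then have bad_i: "bad i" and "i \<le> n" unfolding i_def by (auto intro: LeastI Least_le)
  then have i: "1 \<le> i" "i \<le> c" using n by (auto simp: bad_def)
  have good: "g = 0" if "1 \<le> j" "j < i" "g \<in> ?K j" "T g = g" for j g
    using not_less_Least[of j bad] that by (auto simp: i_def bad_def)
  have SM: "x \<in> carrier ?M" if "x \<in> S" for x using that S subgroup.mem_carrier by metis
  have T_lead: "hom_part j (subst r p x - 1) = T (hom_part j (x - 1))" if "ord_ge j (x - 1)" for x j
    using hom_part_subst[of r p j "x - 1", OF p that] by (simp add: T subst.diff subst_one[OF p])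
  have p_ord: "ord_ge j (subst r p x - 1)" if "ord_ge j (x - 1)" for x j
    using ord_ge_subst[of r p j "x - 1", OF p that] by (simp add: subst.diff subst_one[OF p])
  have linT: "Vector_Spaces.linear scale scale T" unfolding T by (rule linear_subst)
  interpret T: Vector_Spaces.linear scale scale T by (rule linT)
  define D where "D = (\<lambda>f. T f - f)"
  have linD: "Vector_Spaces.linear scale scale D"
    by unfold_locales (simp_all add: D_def T.add T.scale series.scale_right_diff_distrib)
  interpret D: Vector_Spaces.linear scale scale D by (rule linD)
  have T_K: "T g \<in> ?K i" if "g \<in> ?K i" for g
  proof -
    have "T ` leading_terms S i \<subseteq> leading_terms S i"
    proof
      fix h assume "h \<in> T ` leading_terms S i"
      then obtain x where x: "x \<in> S" "ord_ge i (x - 1)" "h = T (hom_part i (x - 1))"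
        by (auto simp: leading_terms_def)
      then have "h = hom_part i (subst r p x - 1)" "subst r p x \<in> S" "ord_ge i (subst r p x - 1)"
        using T_lead p_ord inv by auto
      then show "h \<in> leading_terms S i" by (auto simp: leading_terms_def)
    qed
    then have "T ` ?K i \<subseteq> ?K i" by (metis T.span_image series.span_mono)
    then show ?thesis using that by blast
  qed
  then have D_K: "D ` ?K i \<subseteq> ?K i" by (auto simp: D_def intro: series.span_diff)
  have fin: "?K i \<subseteq> series.span (monomial ` words r i)"
  proof (rule series.span_minimal[OF _ series.subspace_span])
    show "leading_terms S i \<subseteq> series.span (monomial ` words r i)"
      using SM by (auto simp: leading_terms_def in_magnus_group_iff
        intro!: homogeneous_in_span_monomials supported_diff)
  qed
  have "\<not> inj_on D (?K i)"
  proof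
    assume "inj_on D (?K i)"
    then have "\<And>g. g \<in> ?K i \<Longrightarrow> D g = 0 \<Longrightarrow> g = 0"
      using D.inj_on_iff_eq_0[OF series.subspace_span] by blast
    then show False using bad_i by (auto simp: bad_def D_def)
  qed
  then have "\<not> ?K i \<subseteq> D ` ?K i"
    using series.finite_dim_inj_on_iff_surj_on[OF linD series.subspace_span fin _ D_K] by simp
  moreover have "series.subspace (D ` ?K i)"
    by (rule D.subspace_image[OF series.subspace_span])
  ultimately have "\<not> leading_terms S i \<subseteq> D ` ?K i"
    using series.span_minimal by blast
  then obtain x where x: "x \<in> S" "ord_ge i (x - 1)" "hom_part i (x - 1) \<notin> D ` ?K i"
    by (auto simp: leading_terms_def)
  have False if kl: "k \<noteq> l" and y: "y \<in> S"
    and tw: "ord_ge (Suc c) (subst r p y * x [^]\<^bsub>?M\<^esub> k - x [^]\<^bsub>?M\<^esub> l * y)" for k l :: nat and y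
  proof -
    let ?u = "x [^]\<^bsub>?M\<^esub> k" and ?v = "x [^]\<^bsub>?M\<^esub> l" and ?z = "subst r p y"
    have u: "ord_ge i (?u - 1)" "hom_part i (?u - 1) = scale (of_nat k) (hom_part i (x - 1))"
      and v: "ord_ge i (?v - 1)" "hom_part i (?v - 1) = scale (of_nat l) (hom_part i (x - 1))"
      using magnus_pow_leading_term[OF SM[OF x(1)] x(2) i(1)] by blast+
    have split: "?z - y = (?z * ?u - ?v * y) - ?z * (?u - 1) + (?v - 1) * y"
      by (simp add: algebra_simps)
    \<comment> \<open>Below degree \<open>i\<close> the powers of \<open>x\<close> are invisible, so the leading term of \<open>y\<close> is fixed by \<open>T\<close>.\<close>
    have "1 \<le> j \<Longrightarrow> j \<le> i \<Longrightarrow> ord_ge j (y - 1)" for j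
    proof (induction j rule: nat_induct_at_least)
      case base
      then show ?case using magnus_group_ord_ge SM y by blast
    next
      case (Suc j)
      then have y1: "ord_ge j (y - 1)" by simp
      have "ord_ge (Suc j) (?z * ?u - ?v * y)" using tw Suc.prems i by (auto intro: ord_ge_mono)
      moreover have "ord_ge (Suc j) (?z * (?u - 1))"
        using u(1) Suc.prems by (intro ord_ge_mult_right) (rule ord_ge_mono)
      moreover have "ord_ge (Suc j) ((?v - 1) * y)"
        using v(1) Suc.prems by (intro ord_ge_mult_left) (rule ord_ge_mono)
      ultimately have "ord_ge (Suc j) (?z - y)"
        unfolding split by (rule ord_ge_add[OF ord_ge_diff])
      then have "hom_part j (?z - 1) = hom_part j (y - 1)"
        by (intro hom_part_eq) simp
      then have "T (hom_part j (y - 1)) = hom_part j (y - 1)" using T_lead[OF y1] by simp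
      moreover have "hom_part j (y - 1) \<in> ?K j"
        using y y1 by (auto intro!: series.span_base simp: leading_terms_def)
      ultimately have "hom_part j (y - 1) = 0" using good[of j] Suc by simp
      then show ?case using hom_part_eq_0_iff[OF y1] by simp
    qed
    then have y1: "ord_ge i (y - 1)" using i by simp
    let ?m = "hom_part i (y - 1)"
    have m: "?m \<in> ?K i"
      using y y1 by (auto intro!: series.span_base simp: leading_terms_def)
    \<comment> \<open>In degree \<open>i\<close> all products of two terms of positive order vanish, and the relation becomes additive.\<close>
    have "(?z - 1) - (y - 1) - ((?v - 1) - (?u - 1))
        = (?z * ?u - ?v * y) - (?z - 1) * (?u - 1) + (?v - 1) * (y - 1)"
      by (simp add: algebra_simps)
    moreover have "ord_ge (Suc i) \<dots>"
    proof (rule ord_ge_add[OF ord_ge_diff])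
      show "ord_ge (Suc i) (?z * ?u - ?v * y)" using tw i by (auto intro: ord_ge_mono)
      have "ord_ge (i + i) ((?z - 1) * (?u - 1))"
        using p_ord[OF y1] u(1) by (rule ord_ge_mult)
      then show "ord_ge (Suc i) ((?z - 1) * (?u - 1))"
        by (rule ord_ge_mono) (use i(1) in simp)
      have "ord_ge (i + i) ((?v - 1) * (y - 1))"
        using v(1) y1 by (rule ord_ge_mult)
      then show "ord_ge (Suc i) ((?v - 1) * (y - 1))"
        by (rule ord_ge_mono) (use i(1) in simp)
    qed
    ultimately have "hom_part i ((?z - 1) - (y - 1)) = hom_part i ((?v - 1) - (?u - 1))"
      by (intro hom_part_eq) simp
    then have "D ?m = scale (of_nat l - of_nat k) (hom_part i (x - 1))"
      unfolding hom_part_diff[of i "?z - 1" "y - 1"] hom_part_diff[of i "?v - 1" "?u - 1"]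
      by (simp only: T_lead[OF y1] u(2) v(2) D_def series.scale_left_diff_distrib)
    then have "scale (inverse (of_nat l - of_nat k)) (D ?m) = hom_part i (x - 1)"
      using kl by simp
    then have "hom_part i (x - 1) = D (scale (inverse (of_nat l - of_nat k)) ?m)"
      by (simp only: D.scale)
    then show False using x(3) m series.span_scale by blast
  qed
  then show ?thesis using x(1) by blast
qed

section \<open>The Magnus homomorphism on the free group\<close>

lemma (in group_hom) subgroup_preimage:
  assumes "subgroup K H" shows "subgroup {g \<in> carrier G. h g \<in> K} G"
proof -
  interpret K: subgroup K H by fact
  show ?thesis by (rule G.subgroupI) (auto intro: exI[of _ \<one>])
qed

lemma carrier_free_grp: "w \<in> carrier (free_grp r) \<longleftrightarrow> reduced w \<and> fst ` set w \<subseteq> {..<r}"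
  by (simp add: free_grp_def)

lemma generator_in_free_grp: "i < r \<Longrightarrow> [(i, b)] \<in> carrier (free_grp r)"
  by (simp add: carrier_free_grp reduced_Cons)

lemma (in group) free_grp_hom_unique:
  assumes h: "h \<in> hom (free_grp r) G" and k: "k \<in> hom (free_grp r) G"
    and eq: "\<And>i. i < r \<Longrightarrow> h [(i, True)] = k [(i, True)]"
    and w: "w \<in> carrier (free_grp r)"
  shows "h w = k w"
proof -
  interpret F: group "free_grp r" by (rule group_free_grp)
  interpret h: group_hom "free_grp r" G h using h by unfold_locales
  interpret k: group_hom "free_grp r" G k using k by unfold_locales
  have inv: "[(i, False)] = inv\<^bsub>free_grp r\<^esub> [(i, True)]" if "i < r" for i
  proof (rule F.inv_equality[symmetric])
    show "[(i, False)] \<otimes>\<^bsub>free_grp r\<^esub> [(i, True)] = \<one>\<^bsub>free_grp r\<^esub>"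
      by (simp add: free_grp_def reduce_def inv_letter_def)
  qed (use that in \<open>simp_all add: generator_in_free_grp\<close>)
  have letter: "h [a] = k [a]" if "fst a < r" for a
  proof (cases a)
    case (Pair i b)
    then show ?thesis
      using that eq inv by (cases b) (simp_all add: generator_in_free_grp)
  qed
  show ?thesis using w
  proof (induction w)
    case Nil
    then show ?case using h.hom_one k.hom_one by (simp add: free_grp_def)
  next
    case (Cons a w)
    have aw: "[a] \<in> carrier (free_grp r)" "w \<in> carrier (free_grp r)" "fst a < r"
      using Cons.prems by (auto simp: carrier_free_grp reduced_Cons)
    have "a # w = [a] \<otimes>\<^bsub>free_grp r\<^esub> w"
      using Cons.prems reduce_id[of "a # w"] by (simp add: free_grp_def)
    then show ?case using Cons.IH aw letter by simp
  qed
qed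

definition magnus :: "nat \<Rightarrow> letter list \<Rightarrow> ncseries" where
  "magnus r = (SOME h. h \<in> hom (free_grp r) (magnus_group r) \<and> (\<forall>i<r. h [(i, True)] = 1 + letter i))"

lemma magnus_hom: "magnus r \<in> hom (free_grp r) (magnus_group r)"
  and magnus_generator: "i < r \<Longrightarrow> magnus r [(i, True)] = 1 + letter i"
proof -
  have "1 + letter i \<in> carrier (magnus_group r)" if "i < r" for i
    using that by (auto simp: in_magnus_group_iff wcoeff_one wcoeff_letter
        intro!: supported_add supported_letter integral_add)
  then have "\<exists>h. h \<in> hom (free_grp r) (magnus_group r) \<and> (\<forall>i<r. h [(i, True)] = 1 + letter i)"
    using magnus.free_grp_universal[of r "\<lambda>i. 1 + letter i" r] by blast
  from someI_ex[OF this]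
  show "magnus r \<in> hom (free_grp r) (magnus_group r)"
    and "i < r \<Longrightarrow> magnus r [(i, True)] = 1 + letter i"
    by (auto simp: magnus_def)
qed

interpretation free: group "free_grp r" for r by (rule group_free_grp)

interpretation magnus_hom: group_hom "free_grp r" "magnus_group r" "magnus r" for r
  by unfold_locales (rule magnus_hom)

lemma magnus_lower_central:
  assumes "1 \<le> n" "g \<in> lower_central (free_grp r) n"
  shows "magnus r g \<in> magnus_filtration r n"
  using assms
proof (induction n arbitrary: g rule: nat_induct_at_least)
  case base
  then have "magnus r g \<in> carrier (magnus_group r)" by simp
  then show ?case using magnus_group_ord_ge by (simp add: magnus_filtration_def)
next
  case (Suc n)
  let ?F = "free_grp r"
  define H where "H = {g \<in> carrier ?F. magnus r g \<in> magnus_filtration r (Suc n)}"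
  have "subgroup H ?F"
    unfolding H_def using subgroup_magnus_filtration
    by (rule magnus_hom.subgroup_preimage)
  obtain m where n: "n = Suc m" using Suc.hyps by (cases n) auto
  have sub: "lower_central ?F n \<subseteq> carrier ?F"
    using free.lower_central_normal normal_imp_subgroup subgroup.subset by metis
  have "(\<Union>h\<in>lower_central ?F n. \<Union>k\<in>carrier ?F.
      {h \<otimes>\<^bsub>?F\<^esub> k \<otimes>\<^bsub>?F\<^esub> inv\<^bsub>?F\<^esub> h \<otimes>\<^bsub>?F\<^esub> inv\<^bsub>?F\<^esub> k}) \<subseteq> H"
  proof safe
    fix h k assume hk: "h \<in> lower_central ?F n" "k \<in> carrier ?F"
    then have h: "h \<in> carrier ?F" using sub by blast
    have "magnus r h \<in> magnus_filtration r n" using Suc.IH hk(1) .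
    then show "h \<otimes>\<^bsub>?F\<^esub> k \<otimes>\<^bsub>?F\<^esub> inv\<^bsub>?F\<^esub> h \<otimes>\<^bsub>?F\<^esub> inv\<^bsub>?F\<^esub> k \<in> H"
      using commutator_in_magnus_filtration(1)[of "magnus r h" r n "magnus r k"] h hk(2)
      by (simp add: H_def)
  qed
  then have "generate ?F (\<Union>h\<in>lower_central ?F n. \<Union>k\<in>carrier ?F.
      {h \<otimes>\<^bsub>?F\<^esub> k \<otimes>\<^bsub>?F\<^esub> inv\<^bsub>?F\<^esub> h \<otimes>\<^bsub>?F\<^esub> inv\<^bsub>?F\<^esub> k}) \<subseteq> H"
    using \<open>subgroup H ?F\<close> by (rule free.generate_subgroup_incl)
  then show ?case using Suc.prems by (auto simp: n commutator_subgroup_def H_def)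
qed

text \<open>
  The corresponding iterated group commutator of the generators has this leading term.
\<close>
lemma left_normed_letter_is_leading_term:
  assumes w: "w \<in> words r n" and n: "1 \<le> n"
  shows "left_normed letter w \<in> leading_terms (magnus r ` carrier (free_grp r)) n"
proof -
  let ?F = "free_grp r" and ?M = "magnus_group r"
  have len: "length v = length w" if "wcoeff (left_normed letter w) v \<noteq> 0" for v w
    using mset_left_normed_letter[OF that] by (metis size_mset)
  have ord: "ord_ge (length w) (left_normed letter w)" for w
    unfolding ord_ge_def using len by (metis less_irrefl)
  have "\<exists>x\<in>carrier ?F. ord_ge (Suc (length w)) (magnus r x - 1 - left_normed letter w)"
    if "w \<noteq> []" "set w \<subseteq> {..<r}" for w
    using that
  proof (induction w rule: rev_induct)
    case (snoc j w)
    have j: "[(j, True)] \<in> carrier ?F" "magnus r [(j, True)] = 1 + letter j"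
      using snoc.prems by (simp_all add: generator_in_free_grp magnus_generator)
    show ?case
    proof (cases "w = []")
      case True
      have "ord_ge (Suc (length (w @ [j]))) (magnus r [(j, True)] - 1 - left_normed letter (w @ [j]))"
        by (simp add: True j(2))
      then show ?thesis using j(1) by blast
    next
      case False
      then obtain x where x: "x \<in> carrier ?F"
          and xw: "ord_ge (Suc (length w)) (magnus r x - 1 - left_normed letter w)"
        using snoc.IH snoc.prems(2) by auto
      let ?l = "left_normed letter w"
      let ?c = "x \<otimes>\<^bsub>?F\<^esub> [(j, True)] \<otimes>\<^bsub>?F\<^esub> inv\<^bsub>?F\<^esub> x \<otimes>\<^bsub>?F\<^esub> inv\<^bsub>?F\<^esub> [(j, True)]"
      have "ord_ge (length w) (magnus r x - 1 - ?l + ?l)"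
        by (intro ord_ge_add ord ord_ge_mono[OF xw]) simp
      then have x1: "magnus r x \<in> magnus_filtration r (length w)"
        using x by (simp add: magnus_filtration_def)
      have "ord_ge (length w + 2) (magnus r ?c - 1 - bracket (magnus r x - 1) (letter j))"
        using commutator_in_magnus_filtration(2)[OF x1, of "magnus r [(j, True)]"] x j(1)
          magnus_hom.hom_closed[OF j(1)]
        by (simp add: j(2))
      moreover have "ord_ge (length w + 2) (bracket (magnus r x - 1 - ?l) (letter j))"
      proof -
        have "ord_ge (Suc (length w) + 1) ((magnus r x - 1 - ?l) * letter j)"
          "ord_ge (1 + Suc (length w)) (letter j * (magnus r x - 1 - ?l))"
          using xw ord_ge_letter by (intro ord_ge_mult; simp)+
        then show ?thesis by (simp add: bracket_def ord_ge_diff)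
      qed
      ultimately have "ord_ge (length w + 2)
         ((magnus r ?c - 1 - bracket (magnus r x - 1) (letter j)) + bracket (magnus r x - 1 - ?l) (letter j))"
        by (rule ord_ge_add)
      moreover have "(magnus r ?c - 1 - bracket (magnus r x - 1) (letter j)) + bracket (magnus r x - 1 - ?l) (letter j)
          = magnus r ?c - 1 - left_normed letter (w @ [j])"
        unfolding left_normed_snoc[OF False] by (simp add: bracket_def left_diff_distrib right_diff_distrib)
      ultimately have "ord_ge (Suc (length (w @ [j]))) (magnus r ?c - 1 - left_normed letter (w @ [j]))"
        by simp
      moreover have "?c \<in> carrier ?F" using x j(1) by simp
      ultimately show ?thesis by blast
    qed
  qed simp
  moreover have "w \<noteq> []" "set w \<subseteq> {..<r}" "length w = n"
    using w n by (auto simp: words_def)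
  ultimately obtain x where x: "x \<in> carrier ?F" "ord_ge (Suc n) (magnus r x - 1 - left_normed letter w)"
    by metis
  have "ord_ge n (magnus r x - 1 - left_normed letter w + left_normed letter w)"
    using ord_ge_mono[OF x(2)] ord[of w] w by (intro ord_ge_add) (simp_all add: words_def)
  then have "ord_ge n (magnus r x - 1)" by simp
  moreover have "hom_part n (magnus r x - 1) = hom_part n (left_normed letter w)"
    by (rule hom_part_eq[OF x(2)])
  moreover have "hom_part n (left_normed letter w) = left_normed letter w"
  proof (rule ncseries_eqI)
    show "wcoeff (hom_part n (left_normed letter w)) v = wcoeff (left_normed letter w) v" for v
      using len[of w v] w by (auto simp: wcoeff_hom_part words_def)
  qed
  ultimately have "left_normed letter w = hom_part n (magnus r x - 1)" "ord_ge n (magnus r x - 1)"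
    by simp_all
  then show ?thesis unfolding leading_terms_def using x(1) by blast
qed

lemma lie_subset_span_leading_terms:
  "1 \<le> n \<Longrightarrow> lie r n \<subseteq> series.span (leading_terms (magnus r ` carrier (free_grp r)) n)"
  unfolding lie_def
  by (intro series.span_mono image_subsetI left_normed_letter_is_leading_term)

section \<open>Lifting endomorphisms of the free nilpotent group\<close>

definition nilpotent_class :: "nat \<Rightarrow> nat \<Rightarrow> letter list \<Rightarrow> letter list set" where
  "nilpotent_class r c g = lower_central (free_grp r) (c + 1) #>\<^bsub>free_grp r\<^esub> g"

lemma nilpotent_class_hom: "nilpotent_class r c \<in> hom (free_grp r) (free_nilpotent_grp r c)"
  unfolding nilpotent_class_def free_nilpotent_grp_def
  by (rule normal.r_coset_hom_Mod[OF free.lower_central_normal])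

lemma carrier_free_nilpotent_grp:
  "carrier (free_nilpotent_grp r c) = nilpotent_class r c ` carrier (free_grp r)"
  by (auto simp: free_nilpotent_grp_def FactGroup_def RCOSETS_def nilpotent_class_def)

text \<open>
  Elements of \<open>\<gamma>\<^bsub>c+1\<^esub>\<close> are \<open>1\<close> up to degree \<open>c\<close>, so the Magnus expansion up to degree \<open>c\<close> is defined on the
  free nilpotent group.
\<close>
lemma nilpotent_class_eqD:
  assumes "g \<in> carrier (free_grp r)" "h \<in> carrier (free_grp r)"
    and "nilpotent_class r c g = nilpotent_class r c h"
  shows "ord_ge (Suc c) (magnus r g - magnus r h)"
proof -
  let ?F = "free_grp r" and ?N = "lower_central (free_grp r) (c + 1)"
  have sub: "subgroup ?N ?F" using free.lower_central_normal by (rule normal_imp_subgroup)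
  have "g \<in> ?N #>\<^bsub>?F\<^esub> h"
    using free.rcos_self[OF assms(1) sub] assms(3) by (simp add: nilpotent_class_def)
  then obtain n where n: "n \<in> ?N" "g = n \<otimes>\<^bsub>?F\<^esub> h" by (auto simp: r_coset_def)
  have "ord_ge (Suc c) (magnus r n - 1)"
    using magnus_lower_central[of "c + 1" n r] n(1) by (simp add: magnus_filtration_def)
  then have "ord_ge (Suc c) ((magnus r n - 1) * magnus r h)" by (rule ord_ge_mult_left)
  moreover have "n \<in> carrier ?F" using n(1) sub subgroup.mem_carrier by metis
  then have "(magnus r n - 1) * magnus r h = magnus r g - magnus r h"
    using n(2) assms(2) by (simp add: left_diff_distrib)
  ultimately show ?thesis by simp
qed

lemma free_nilpotent_hom_lift:
  assumes \<phi>: "\<phi> \<in> hom (free_nilpotent_grp r c) (free_nilpotent_grp r c)"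
  obtains \<theta> where "\<theta> \<in> hom (free_grp r) (free_grp r)"
    and "\<And>g. g \<in> carrier (free_grp r) \<Longrightarrow> \<phi> (nilpotent_class r c g) = nilpotent_class r c (\<theta> g)"
proof -
  let ?F = "free_grp r" and ?N = "free_nilpotent_grp r c" and ?q = "nilpotent_class r c"
  interpret N: group ?N by (rule group_free_nilpotent_grp)
  have "\<exists>a\<in>carrier ?F. \<phi> (?q [(i, True)]) = ?q a" if "i < r" for i
  proof -
    have "\<phi> (?q [(i, True)]) \<in> carrier ?N"
      by (rule hom_in_carrier[OF \<phi> hom_in_carrier[OF nilpotent_class_hom generator_in_free_grp[OF that]]])
    then show ?thesis by (auto simp: carrier_free_nilpotent_grp)
  qed
  then obtain a where a: "\<And>i. i < r \<Longrightarrow> a i \<in> carrier ?F \<and> \<phi> (?q [(i, True)]) = ?q (a i)"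
    by metis
  then obtain \<theta> where \<theta>: "\<theta> \<in> hom ?F ?F" "\<And>i. i < r \<Longrightarrow> \<theta> [(i, True)] = a i"
    using free.free_grp_universal[of r a r] by blast
  have "(\<phi> \<circ> ?q) g = (?q \<circ> \<theta>) g" if "g \<in> carrier ?F" for g
    by (rule N.free_grp_hom_unique[OF hom_compose[OF nilpotent_class_hom \<phi>]
          hom_compose[OF \<theta>(1) nilpotent_class_hom] _ that]) (simp add: a \<theta>(2))
  then show thesis using that \<theta>(1) by simp
qed

text \<open>
  The series substituted for the variables by the endomorphism \<open>\<theta>\<close>; the variable itself is the
  Magnus image of its generator minus \<open>1\<close>.
\<close>
definition magnus_images :: "nat \<Rightarrow> (letter list \<Rightarrow> letter list) \<Rightarrow> nat \<Rightarrow> ncseries" where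
  "magnus_images r \<theta> i = magnus r (\<theta> [(i, True)]) - 1"

lemma ord_ge_magnus_images:
  assumes "\<theta> \<in> hom (free_grp r) (free_grp r)" "i < r"
  shows "ord_ge 1 (magnus_images r \<theta> i)"
  unfolding magnus_images_def
  using hom_in_carrier[OF assms(1) generator_in_free_grp[OF assms(2)]]
  by (intro magnus_group_ord_ge[of _ r] magnus_hom.hom_closed)

text \<open>
  Both sides are homomorphisms on the free group that agree on the generators.
\<close>
lemma magnus_endomorphism:
  assumes \<theta>: "\<theta> \<in> hom (free_grp r) (free_grp r)" and g: "g \<in> carrier (free_grp r)"
  shows "magnus r (\<theta> g) = subst r (magnus_images r \<theta>) (magnus r g)"
proof -
  let ?p = "magnus_images r \<theta>"
  note p = ord_ge_magnus_images[OF \<theta>]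
  have p_in: "1 + ?p i \<in> carrier (magnus_group r)" if "i < r" for i
    using magnus_hom.hom_closed[OF hom_in_carrier[OF \<theta> generator_in_free_grp[OF that]]]
    by (simp add: magnus_images_def)
  have p_int: "supported r (?p i)" "integral_series (?p i)" if "i < r" for i
    using p_in[OF that] supported_diff[of r "1 + ?p i" 1] integral_diff[of "1 + ?p i" 1]
    by (simp_all add: in_magnus_group_iff)
  have "subst r ?p \<in> hom (magnus_group r) (magnus_group r)"
    using p p_int
    by (auto simp: hom_def in_magnus_group_iff subst_mult wcoeff_subst_Nil supported_subst
        integral_subst)
  from hom_compose[OF magnus_hom this]
  have 1: "subst r ?p \<circ> magnus r \<in> hom (free_grp r) (magnus_group r)" .
  have 2: "magnus r \<circ> \<theta> \<in> hom (free_grp r) (magnus_group r)"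
    by (rule hom_compose[OF \<theta> magnus_hom])
  have "(magnus r \<circ> \<theta>) g = (subst r ?p \<circ> magnus r) g"
  proof (rule magnus.free_grp_hom_unique[OF 2 1 _ g])
    fix i assume i: "i < r"
    then show "(magnus r \<circ> \<theta>) [(i, True)] = (subst r ?p \<circ> magnus r) [(i, True)]"
      using p by (simp add: magnus_generator subst_add subst_one subst_letter) (simp add: magnus_images_def)
  qed
  then show ?thesis by simp
qed

section \<open>The determinant on the abelianization\<close>

definition abelianized :: "nat \<Rightarrow> (letter list \<Rightarrow> letter list) \<Rightarrow> complex mat" where
  "abelianized r \<theta> = mat r r (\<lambda>(j, i). wcoeff (magnus_images r \<theta> i) [j])"

lemma abelianized_carrier [simp]: "abelianized r \<theta> \<in> carrier_mat r r"
  by (simp add: abelianized_def)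

lemma column_form_abelianized:
  assumes "\<theta> \<in> hom (free_grp r) (free_grp r)" "i < r"
  shows "column_form (abelianized r \<theta>) i = hom_part 1 (magnus_images r \<theta> i)"
proof (rule ncseries_eqI)
  fix w
  have "supported r (magnus_images r \<theta> i)"
    using magnus_hom.hom_closed[OF hom_in_carrier[OF assms(1) generator_in_free_grp[OF assms(2)]]]
    by (simp add: magnus_images_def in_magnus_group_iff supported_diff)
  then show "wcoeff (column_form (abelianized r \<theta>) i) w = wcoeff (hom_part 1 (magnus_images r \<theta> i)) w"
    unfolding column_form_def wcoeff_letter_combination wcoeff_hom_part
    using assms(2) by (cases w) (auto simp: abelianized_def supported_def)
qed

lemma integral_det:
  assumes "A \<in> carrier_mat r r" "\<And>i j. i < r \<Longrightarrow> j < r \<Longrightarrow> A $$ (i, j) \<in> \<int>"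
  shows "det A \<in> (\<int> :: complex set)"
proof -
  have "det A = (\<Sum>p\<in>{p. p permutes {0..<r}}. signof p * (\<Prod>i=0..<r. A $$ (i, p i)))"
    by (rule det_def'[OF assms(1)])
  also have "\<dots> \<in> \<int>"
  proof (intro Ints_sum Ints_mult Ints_prod assms(2))
    fix p i assume "p \<in> {p. p permutes {0..<r}}" "i \<in> {0..<r}"
    then show "p i < r" using permutes_in_image[of p "{0..<r}" i] by simp
  qed simp_all
  finally show ?thesis .
qed

lemma det_abelianized_integral:
  assumes \<theta>: "\<theta> \<in> hom (free_grp r) (free_grp r)"
  shows "det (abelianized r \<theta>) \<in> \<int>"
proof (rule integral_det[OF abelianized_carrier])
  fix i j assume ij: "i < r" "j < r"
  have "integral_series (magnus_images r \<theta> j)"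
    using magnus_hom.hom_closed[OF hom_in_carrier[OF \<theta> generator_in_free_grp[OF ij(2)]]]
    by (simp add: magnus_images_def in_magnus_group_iff integral_diff)
  then show "abelianized r \<theta> $$ (i, j) \<in> \<int>"
    using ij by (simp add: abelianized_def integral_series_def)
qed

lemma Ints_unit_square:
  assumes "a \<in> \<int>" "b \<in> \<int>" "a * b = (1 :: complex)" shows "a\<^sup>2 = 1"
proof -
  obtain m n where mn: "a = of_int m" "b = of_int n" using assms(1,2) by (auto elim!: Ints_cases)
  then have "of_int (m * n) = (of_int 1 :: complex)" using assms(3) by simp
  then have "m * n = 1" by (simp only: of_int_eq_iff)
  then have "m = 1 \<or> m = -1" using zmult_eq_1_iff by auto
  then show ?thesis using mn by auto
qed

text \<open>
  As \<open>\<theta> \<circ> \<eta>\<close> is the identity modulo degree \<open>2\<close>, the integral matrices of \<open>\<theta>\<close> and \<open>\<eta>\<close> are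
  inverse to each other, and a determinant that is a unit of the integers has square \<open>1\<close>.
\<close>
lemma det_abelianized_automorphism:
  assumes \<theta>: "\<theta> \<in> hom (free_grp r) (free_grp r)" and \<eta>: "\<eta> \<in> hom (free_grp r) (free_grp r)"
    and inv: "\<And>i. i < r \<Longrightarrow> ord_ge 2 (magnus r (\<theta> (\<eta> [(i, True)])) - magnus r [(i, True)])"
  shows "(det (abelianized r \<theta>))\<^sup>2 = 1"
proof -
  let ?A = "abelianized r \<theta>" and ?B = "abelianized r \<eta>"
  have "column_form (?A * ?B) i = letter i" if i: "i < r" for i
  proof -
    let ?x = "[(i, True)]"
    have x: "?x \<in> carrier (free_grp r)" using i by (rule generator_in_free_grp)
    have "column_form (?A * ?B) i = subst r (column_form ?A) (column_form ?B i)"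
      by (rule column_form_mult[OF _ _ i]) simp_all
    also have "\<dots> = subst r (\<lambda>i. hom_part 1 (magnus_images r \<theta> i)) (column_form ?B i)"
      by (rule subst_cong) (rule column_form_abelianized[OF \<theta>])
    also have "column_form ?B i = hom_part 1 (magnus_images r \<eta> i)"
      by (rule column_form_abelianized[OF \<eta> i])
    also have "subst r (\<lambda>i. hom_part 1 (magnus_images r \<theta> i)) (hom_part 1 (magnus_images r \<eta> i))
        = hom_part 1 (subst r (magnus_images r \<theta>) (magnus_images r \<eta> i))"
      by (rule hom_part_subst[OF ord_ge_magnus_images[OF \<theta>] ord_ge_magnus_images[OF \<eta> i], symmetric])
    also have "subst r (magnus_images r \<theta>) (magnus_images r \<eta> i) = magnus r (\<theta> (\<eta> ?x)) - 1"
      using magnus_endomorphism[OF \<theta> hom_in_carrier[OF \<eta> x]]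
      by (simp add: magnus_images_def subst.diff subst_one[OF ord_ge_magnus_images[OF \<theta>], simplified])
    also have "hom_part 1 \<dots> = hom_part 1 (letter i)"
      using inv[OF i] i by (intro hom_part_eq) (simp add: magnus_generator numeral_2_eq_2 algebra_simps)
    also have "\<dots> = letter i"
      by (auto intro!: ncseries_eqI simp: wcoeff_hom_part wcoeff_letter)
    finally show ?thesis .
  qed
  then have "?A * ?B = 1\<^sub>m r"
  proof (intro eq_matI)
    fix a i assume "a < dim_row (1\<^sub>m r :: complex mat)" "i < dim_col (1\<^sub>m r :: complex mat)"
    then show "(?A * ?B) $$ (a, i) = 1\<^sub>m r $$ (a, i)"
      using wcoeff_column_form[of a "?A * ?B" i] \<open>\<And>i. i < r \<Longrightarrow> column_form (?A * ?B) i = letter i\<close>[of i]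
      by (simp add: wcoeff_letter abelianized_def)
  qed (simp_all add: abelianized_def)
  then have "det ?A * det ?B = 1"
    using det_mult[of ?A r ?B] by simp
  then show ?thesis
    using Ints_unit_square[OF det_abelianized_integral[OF \<theta>] det_abelianized_integral[OF \<eta>]] by blast
qed

section \<open>Reidemeister numbers of free nilpotent groups\<close>

theorem R_infinity_free_nilpotent_grp:
  assumes r: "2 \<le> r" and c: "2 * r \<le> c"
  shows "R_infinity (free_nilpotent_grp r c)"
  unfolding R_infinity_def
proof (intro conjI ballI)
  let ?F = "free_grp r" and ?N = "free_nilpotent_grp r c" and ?M = "magnus_group r"
    and ?q = "nilpotent_class r c"
  interpret N: group ?N by (rule group_free_nilpotent_grp)
  show "group ?N" by (rule group_free_nilpotent_grp)
  interpret q: group_hom ?F ?N ?q by unfold_locales (rule nilpotent_class_hom)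
  fix \<phi> assume iso: "\<phi> \<in> iso ?N ?N"
  then have hom: "\<phi> \<in> hom ?N ?N" by (simp add: iso_def)
  obtain \<theta> where \<theta>: "\<theta> \<in> hom ?F ?F" "\<And>g. g \<in> carrier ?F \<Longrightarrow> \<phi> (?q g) = ?q (\<theta> g)"
    using free_nilpotent_hom_lift[OF hom] by blast
  let ?\<psi> = "inv_into (carrier ?N) \<phi>"
  have "?\<psi> \<in> hom ?N ?N" using N.iso_set_sym[OF iso] by (simp add: iso_def)
  then obtain \<eta> where \<eta>: "\<eta> \<in> hom ?F ?F" "\<And>g. g \<in> carrier ?F \<Longrightarrow> ?\<psi> (?q g) = ?q (\<eta> g)"
    using free_nilpotent_hom_lift by blast
  define p where "p = magnus_images r \<theta>"
  define S where "S = magnus r ` carrier ?F"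
  define T where "T = subst r (\<lambda>i. hom_part 1 (p i))"
  have \<theta>_carrier: "\<theta> g \<in> carrier ?F" if "g \<in> carrier ?F" for g
    using hom_in_carrier[OF \<theta>(1) that] .
  have "ord_ge 2 (magnus r (\<theta> (\<eta> [(i, True)])) - magnus r [(i, True)])" if "i < r" for i
  proof -
    let ?x = "[(i, True)]"
    have x: "?x \<in> carrier ?F" using that by (rule generator_in_free_grp)
    have \<eta>x: "\<eta> ?x \<in> carrier ?F" using hom_in_carrier[OF \<eta>(1) x] .
    have "?q (\<theta> (\<eta> ?x)) = \<phi> (?\<psi> (?q ?x))" using \<theta>(2)[OF \<eta>x] \<eta>(2)[OF x] by simp
    also have "\<dots> = ?q ?x"
      using iso q.hom_closed[OF x] by (auto simp: iso_def bij_betw_def f_inv_into_f)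
    finally have "ord_ge (Suc c) (magnus r (\<theta> (\<eta> ?x)) - magnus r ?x)"
      using nilpotent_class_eqD \<theta>_carrier \<eta>x x by blast
    then show ?thesis by (rule ord_ge_mono) (use r c in simp)
  qed
  then have det: "(det (abelianized r \<theta>))\<^sup>2 = 1"
    by (rule det_abelianized_automorphism[OF \<theta>(1) \<eta>(1)])
  have T_eq: "T f = subst r (column_form (abelianized r \<theta>)) f" for f
    unfolding T_def p_def by (rule subst_cong) (rule column_form_abelianized[OF \<theta>(1), symmetric])
  obtain f where f: "f \<in> lie r (2 * r)" "f \<noteq> 0" "T f = f"
    using fixed_lie_element[OF r abelianized_carrier det] T_eq by auto
  have f_lead: "f \<in> series.span (leading_terms S (2 * r))"
    using f(1) lie_subset_span_leading_terms[of "2 * r" r] r by (auto simp: S_def)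
  have "subst r p ` S \<subseteq> S"
    using magnus_endomorphism[OF \<theta>(1)] \<theta>_carrier by (force simp: S_def p_def)
  moreover have "subgroup S ?M"
    unfolding S_def by (rule magnus_hom.img_is_subgroup)
  moreover have "ord_ge 1 (p i)" if "i < r" for i
    unfolding p_def by (rule ord_ge_magnus_images[OF \<theta>(1) that])
  ultimately have "\<exists>x\<in>S. \<forall>k l :: nat. k \<noteq> l \<longrightarrow> \<not> (\<exists>y\<in>S.
      ord_ge (Suc c) (subst r p y * x [^]\<^bsub>?M\<^esub> k - x [^]\<^bsub>?M\<^esub> l * y))"
    using r c by (intro infinitely_many_twisted_classes[OF _ _ _ T_def _ _ f_lead f(2,3)]) simp_all
  then obtain x where x: "x \<in> S" and sep: "\<And>k l y. k \<noteq> l \<Longrightarrow> y \<in> S \<Longrightarrow>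
      \<not> ord_ge (Suc c) (subst r p y * x [^]\<^bsub>?M\<^esub> (k :: nat) - x [^]\<^bsub>?M\<^esub> (l :: nat) * y)"
    by blast
  obtain g where g: "g \<in> carrier ?F" "x = magnus r g" using x by (auto simp: S_def)
  define C where "C = (\<lambda>k :: nat. twisted_conj_rel ?N \<phi> `` {?q (g [^]\<^bsub>?F\<^esub> k)})"
  have equiv: "equiv (carrier ?N) (twisted_conj_rel ?N \<phi>)"
    by (rule N.equiv_twisted_conj_rel[OF iso])
  have "inj C"
  proof (rule injI, rule ccontr)
    fix k l assume "C k = C l" and kl: "k \<noteq> l"
    then have "(?q (g [^]\<^bsub>?F\<^esub> k), ?q (g [^]\<^bsub>?F\<^esub> l)) \<in> twisted_conj_rel ?N \<phi>"
      using eq_equiv_class_iff[OF equiv] g(1) by (simp add: C_def)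
    then obtain y where y: "y \<in> carrier ?F"
        "\<phi> (?q y) \<otimes>\<^bsub>?N\<^esub> ?q (g [^]\<^bsub>?F\<^esub> k) = ?q (g [^]\<^bsub>?F\<^esub> l) \<otimes>\<^bsub>?N\<^esub> ?q y"
      by (auto simp: twisted_conj_rel_def carrier_free_nilpotent_grp)
    then have "?q (\<theta> y \<otimes>\<^bsub>?F\<^esub> g [^]\<^bsub>?F\<^esub> k) = ?q (g [^]\<^bsub>?F\<^esub> l \<otimes>\<^bsub>?F\<^esub> y)"
      using \<theta>(2)[OF y(1)] \<theta>_carrier[OF y(1)] g(1) by simp
    then have "ord_ge (Suc c) (magnus r (\<theta> y \<otimes>\<^bsub>?F\<^esub> g [^]\<^bsub>?F\<^esub> k) - magnus r (g [^]\<^bsub>?F\<^esub> l \<otimes>\<^bsub>?F\<^esub> y))"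
      using y(1) \<theta>_carrier g(1) by (intro nilpotent_class_eqD) simp_all
    then have "ord_ge (Suc c) (subst r p (magnus r y) * x [^]\<^bsub>?M\<^esub> k - x [^]\<^bsub>?M\<^esub> l * magnus r y)"
      using y(1) \<theta>_carrier g magnus_endomorphism[OF \<theta>(1) y(1)]
      by (simp add: p_def magnus_hom.hom_nat_pow)
    then show False using sep[OF kl] y(1) by (auto simp: S_def)
  qed
  moreover have "range C \<subseteq> reidemeister_classes ?N \<phi>"
    using g(1) by (auto simp: C_def reidemeister_classes_def intro!: quotientI)
  ultimately have "infinite (reidemeister_classes ?N \<phi>)"
    using finite_subset infinite_UNIV_nat finite_imageD by metis
  then show "reidemeister_number ?N \<phi> = \<infinity>"
    by (simp add: reidemeister_number_def)
qed

theorem theorem2: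
  fixes r c :: nat
  assumes "r \<ge> 2" and "c \<ge> 2"
    and "r = 2 \<or> r = 3 \<Longrightarrow> c \<ge> 4 * r"
    and "r \<ge> 4 \<Longrightarrow> c \<ge> 2 * r"
  shows "R_infinity (free_nilpotent_grp r c)"
proof (rule R_infinity_free_nilpotent_grp)
  consider "r = 2 \<or> r = 3" | "r \<ge> 4" using assms(1) by linarith
  then show "2 * r \<le> c" using assms(3,4) by cases auto
qed (rule assms(1))

end
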